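(* Let $\Gamma$ be an $L$-connection on $M$ with horizontal projector $h=\frac12(I+\Gamma)$, and let $B$ be an $L$-semibasic vector $2$-form on $M$ such that $B^\circ+[C,h]=0$. Then there exists a unique reducible $L$-lift $D$ of $\Gamma$ whose torsion $\mathbf T$ satisfies $\mathbf T(LX,Y)=B(X,Y)$ for all $X,Y\in\mathfrak X(M)$.
   Context: Everything is $C^\infty$. $M$ is a manifold of dimension $2n$ and $\mathfrak X(M)$ is its Lie algebra of vector fields. A vector $k$-form is a $TM$-valued (skew) $k$-form; a vector $1$-form is a field of endomorphisms of $TM$. Brackets of vector forms are Fr\"olicher--Nijenhuis brackets; for a vector field $X$ and a vector $1$-form $K$, $[X,K]Y=[X,KY]-K[X,Y]$. $L$ is a fixed vector $1$-form on $M$ of constant rank $n$ with $[L,L]=0$ and $\mathrm{Im}(L_z)=\mathrm{Ker}(L_z)$ for all $z\in M$ (so $L^2=0$). The vertical bundle is $V(M)=\mathrm{Im}\,L=\mathrm{Ker}\,L$. $C$ denotes the canonical vector field: a fixed vertical vector field on $M$ with $[C,L]=-L$. A vector form $K$ is $L$-semibasic if $LK=0$ and $i_XK=0$ for every vertical vector field $X$. An $L$-semispray is a vector field $S$ with $LS=C$. The potential of an $L$-semibasic vector $k$-form $K$ is the vector $(k-1)$-form $K^\circ=i_SK$, with $S$ an arbitrary $L$-semispray (so $B^\circ(X)=B(S,X)$). An $L$-connection on $M$ is a vector $1$-form $\Gamma$ with $L\Gamma=L$ and $\Gamma L=-L$. A linear connection $D$ on $M$ is $L$-almost-tangent if $D_X(LY)=L(D_XY)$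 for all $X,Y$. Put $K(X)=D_XC$. $D$ is $L$-regular if it is $L$-almost-tangent and $K$ restricts to an isomorphism $V(M)\to V(M)$, with inverse $\varphi$. The $L$-connection induced by an $L$-regular $D$ is $I-2\varphi\circ K$. An $L$-regular $D$ with induced $L$-connection $\Gamma$ is reducible if $D\Gamma=0$, i.e. $D_X(\Gamma Y)=\Gamma(D_XY)$ for all $X,Y$. $D$ is $L$-normal if it is $L$-almost-tangent and $D_{LX}C=LX$ for all $X\in\mathfrak X(M)$ (then it is $L$-regular with $\varphi=I_{V(M)}$). An $L$-lift of an $L$-connection $\Gamma$ is an $L$-normal linear connection whose induced $L$-connection is $\Gamma$; it is a reducible $L$-lift if it is moreover reducible. The torsion of $D$ is $\mathbf T(X,Y)=D_XY-D_YX-[X,Y]$. *)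

theory Defs
  imports "HOL-Analysis.Analysis" "HOL-Library.FuncSet"
begin

section \<open>Smooth maps on open subsets of a Euclidean space\<close>

text \<open>Both notions are meant for open sets \<open>U\<close>: derivatives are full (two-sided) ones.\<close>

fun Ck_on :: "nat \<Rightarrow> 'e::euclidean_space set \<Rightarrow> ('e \<Rightarrow> 'b::real_normed_vector) \<Rightarrow> bool" where
  "Ck_on 0 U f \<longleftrightarrow> continuous_on U f"
| "Ck_on (Suc k) U f \<longleftrightarrow>
     (\<forall>x\<in>U. f differentiable (at x)) \<and> (\<forall>v. Ck_on k U (\<lambda>x. frechet_derivative f (at x) v))"

definition smooth_on :: "'e::euclidean_space set \<Rightarrow> ('e \<Rightarrow> 'b::real_normed_vector) \<Rightarrow> bool" where
  "smooth_on U f \<longleftrightarrow> (\<forall>k. Ck_on k U f)"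


lemma Ck_on_cong:
  assumes "open U" "\<And>x. x \<in> U \<Longrightarrow> f x = g x" "Ck_on k U f"
  shows "Ck_on k U g"
  using assms
proof (induction k arbitrary: f g)
  case 0
  then show ?case using continuous_on_cong by (metis Ck_on.simps(1))
next
  case (Suc k)
  have d: "(g has_derivative frechet_derivative f (at x)) (at x)" if "x \<in> U" for x
  proof (rule has_derivative_transform_within_open)
    show "(f has_derivative frechet_derivative f (at x)) (at x)"
      using Suc.prems(3) that frechet_derivative_works by auto
  qed (use Suc.prems that in auto)
  then have e: "frechet_derivative g (at x) = frechet_derivative f (at x)" if "x \<in> U" for x
    using that by (metis frechet_derivative_at)
  have "Ck_on k U (\<lambda>x. frechet_derivative g (at x) v)" for v
    by (rule Suc.IH[of "\<lambda>x. frechet_derivative f (at x) v"]) (use Suc.prems e in auto)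
  with d show ?case by (auto simp: differentiable_def)
qed

lemma Ck_on_diff:
  assumes "open U" "Ck_on k U f" "Ck_on k U g"
  shows "Ck_on k U (\<lambda>x. f x - g x)"
  using assms
proof (induction k arbitrary: f g)
  case 0
  then show ?case by (auto intro: continuous_intros)
next
  case (Suc k)
  have d: "((\<lambda>x. f x - g x) has_derivative
      (\<lambda>v. frechet_derivative f (at x) v - frechet_derivative g (at x) v)) (at x)" if "x \<in> U" for x
    using Suc.prems that by (auto intro!: has_derivative_diff simp: frechet_derivative_works[symmetric])
  then have e: "frechet_derivative (\<lambda>x. f x - g x) (at x) =
      (\<lambda>v. frechet_derivative f (at x) v - frechet_derivative g (at x) v)" if "x \<in> U" for x
    using that by (metis frechet_derivative_at)
  have "Ck_on k U (\<lambda>x. frechet_derivative (\<lambda>x. f x - g x) (at x) v)" for v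
    by (rule Ck_on_cong[of U "\<lambda>x. frechet_derivative f (at x) v - frechet_derivative g (at x) v"])
      (use Suc e in auto)
  with d show ?case by (auto simp: differentiable_def)
qed


section \<open>Smooth manifolds\<close>

text \<open>A chart is a pair \<open>(U, \<phi>)\<close>; only the values of \<open>\<phi>\<close> on \<open>U\<close> matter. The dimension of the manifold
  is \<open>DIM('e)\<close>. The atlas need not be maximal.\<close>

type_synonym ('a, 'e) chart = "'a set \<times> ('a \<Rightarrow> 'e)"

record ('a, 'e) manifold =
  Top :: "'a topology"
  Atlas :: "('a, 'e) chart set"

abbreviation points :: "('a, 'e) manifold \<Rightarrow> 'a set" where
  "points M \<equiv> topspace (Top M)"

definition chart_inv :: "('a, 'e) chart \<Rightarrow> 'e \<Rightarrow> 'a" where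
  "chart_inv c = inv_into (fst c) (snd c)"

definition transition :: "('a, 'e) chart \<Rightarrow> ('a, 'e) chart \<Rightarrow> 'e \<Rightarrow> 'e" where
  "transition c c' = snd c' \<circ> chart_inv c"

definition is_chart :: "'a topology \<Rightarrow> ('a, 'e::euclidean_space) chart \<Rightarrow> bool" where
  "is_chart T c \<longleftrightarrow> openin T (fst c) \<and> open (snd c ` fst c) \<and>
     homeomorphic_map (subtopology T (fst c)) (top_of_set (snd c ` fst c)) (snd c)"

definition second_countable_top :: "'a topology \<Rightarrow> bool" where
  "second_countable_top T \<longleftrightarrow>
     (\<exists>\<B>. countable \<B> \<and> (\<forall>B\<in>\<B>. openin T B) \<and>
          (\<forall>U x. openin T U \<and> x \<in> U \<longrightarrow> (\<exists>B\<in>\<B>. x \<in> B \<and> B \<subseteq> U)))"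

definition smooth_manifold :: "('a, 'e::euclidean_space) manifold \<Rightarrow> bool" where
  "smooth_manifold M \<longleftrightarrow>
     Hausdorff_space (Top M) \<and> second_countable_top (Top M) \<and>
     (\<forall>c\<in>Atlas M. is_chart (Top M) c) \<and> (\<Union>c\<in>Atlas M. fst c) = points M \<and>
     (\<forall>c\<in>Atlas M. \<forall>c'\<in>Atlas M. smooth_on (snd c ` (fst c \<inter> fst c')) (transition c c'))"

definition smooth_functions :: "('a, 'e::euclidean_space) manifold \<Rightarrow> ('a \<Rightarrow> real) set" where
  "smooth_functions M = {f. \<forall>c\<in>Atlas M. smooth_on (snd c ` fst c) (f \<circ> chart_inv c)}"


section \<open>Tangent vectors and vector fields\<close>

text \<open>At every point \<open>p\<close> one chart of the atlas is singled out. The tangent space at \<open>p\<close> is the model space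
  \<open>'e\<close>, where \<open>v :: 'e\<close> stands for the tangent vector whose components in that chart are \<open>v\<close>. Then
  \<open>tcoord M c p\<close> is the linear isomorphism that sends a tangent vector at \<open>p\<close> to its components in an
  arbitrary chart \<open>c\<close> around \<open>p\<close> (the differential of \<open>c\<close> at \<open>p\<close>).\<close>

definition chart_at :: "('a, 'e) manifold \<Rightarrow> 'a \<Rightarrow> ('a, 'e) chart" where
  "chart_at M p = (SOME c. c \<in> Atlas M \<and> p \<in> fst c)"

definition tcoord :: "('a, 'e::euclidean_space) manifold \<Rightarrow> ('a, 'e) chart \<Rightarrow> 'a \<Rightarrow> 'e \<Rightarrow> 'e" where
  "tcoord M c p = frechet_derivative (transition (chart_at M p) c) (at (snd (chart_at M p) p))"

lemma chart_at:
  assumes "smooth_manifold M" "p \<in> points M"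
  shows "chart_at M p \<in> Atlas M" "p \<in> fst (chart_at M p)"
proof -
  have "\<exists>c. c \<in> Atlas M \<and> p \<in> fst c" using assms unfolding smooth_manifold_def by blast
  from someI_ex[OF this] show "chart_at M p \<in> Atlas M" "p \<in> fst (chart_at M p)"
    by (auto simp: chart_at_def)
qed

lemma chart_inv:
  assumes "smooth_manifold M" "c \<in> Atlas M"
  shows chart_inv_left: "p \<in> fst c \<Longrightarrow> chart_inv c (snd c p) = p"
    and chart_inv_in: "x \<in> snd c ` fst c \<Longrightarrow> chart_inv c x \<in> fst c"
    and chart_inv_right: "x \<in> snd c ` fst c \<Longrightarrow> snd c (chart_inv c x) = x"
    and chart_dom: "fst c \<subseteq> points M" and chart_open: "open (snd c ` fst c)"
proof -
  have c: "is_chart (Top M) c" using assms by (simp add: smooth_manifold_def)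
  show sub: "fst c \<subseteq> points M" and "open (snd c ` fst c)"
    using c by (auto simp: is_chart_def openin_subset)
  have "inj_on (snd c) (fst c)"
    using c homeomorphic_imp_injective_map sub unfolding is_chart_def
    by (metis inf.absorb_iff2 topspace_subtopology)
  then show "p \<in> fst c \<Longrightarrow> chart_inv c (snd c p) = p" by (simp add: chart_inv_def)
  show "x \<in> snd c ` fst c \<Longrightarrow> chart_inv c x \<in> fst c"
    by (simp add: chart_inv_def inv_into_into)
  show "x \<in> snd c ` fst c \<Longrightarrow> snd c (chart_inv c x) = x"
    by (simp add: chart_inv_def f_inv_into_f)
qed

lemma tcoord_chart_at:
  assumes "smooth_manifold M" "p \<in> points M"
  shows "tcoord M (chart_at M p) p v = v"
proof -
  let ?c = "chart_at M p"
  note c = chart_at[OF assms]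
  have "(transition ?c ?c has_derivative (\<lambda>v. v)) (at (snd ?c p))"
    by (rule has_derivative_transform_within_open[OF _ chart_open[OF assms(1) c(1)], where f="\<lambda>x. x"])
      (use c chart_inv_right[OF assms(1) c(1)] in \<open>auto simp: transition_def\<close>)
  then show ?thesis unfolding tcoord_def by (metis frechet_derivative_at)
qed

lemma linear_tcoord:
  assumes "smooth_manifold M" "c \<in> Atlas M" "p \<in> fst c"
  shows "linear (tcoord M c p)"
proof -
  let ?d = "chart_at M p"
  have p: "p \<in> points M" using chart_dom[OF assms(1,2)] assms(3) by blast
  note d = chart_at[OF assms(1) p]
  have "Ck_on (Suc 0) (snd ?d ` (fst ?d \<inter> fst c)) (transition ?d c)"
    using assms d unfolding smooth_manifold_def smooth_on_def by blast
  then have "transition ?d c differentiable (at (snd ?d p))" using d assms(3) by auto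
  then show ?thesis unfolding tcoord_def by (rule linear_frechet_derivative)
qed

text \<open>The component function of a vector field in the chart \<open>c\<close>, on the image of \<open>c\<close>.\<close>

definition vf_rep :: "('a, 'e::euclidean_space) manifold \<Rightarrow> ('a, 'e) chart \<Rightarrow> ('a \<Rightarrow> 'e) \<Rightarrow> 'e \<Rightarrow> 'e" where
  "vf_rep M c X x = tcoord M c (chart_inv c x) (X (chart_inv c x))"

text \<open>Vector fields are \<open>0\<close> off the manifold, so that equality of functions is equality of vector fields.\<close>

definition vector_fields :: "('a, 'e::euclidean_space) manifold \<Rightarrow> ('a \<Rightarrow> 'e) set" where
  "vector_fields M = {X. (\<forall>p. p \<notin> points M \<longrightarrow> X p = 0) \<and>
     (\<forall>c\<in>Atlas M. smooth_on (snd c ` fst c) (vf_rep M c X))}"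

lemma vector_fields_diff:
  assumes "smooth_manifold M" "X \<in> vector_fields M" "Y \<in> vector_fields M"
  shows "(\<lambda>p. X p - Y p) \<in> vector_fields M"
proof -
  have "smooth_on (snd c ` fst c) (vf_rep M c (\<lambda>p. X p - Y p))" if c: "c \<in> Atlas M" for c
    unfolding smooth_on_def
  proof
    fix k
    show "Ck_on k (snd c ` fst c) (vf_rep M c (\<lambda>p. X p - Y p))"
    proof (rule Ck_on_cong[OF chart_open[OF assms(1) c], of "\<lambda>x. vf_rep M c X x - vf_rep M c Y x"])
      show "Ck_on k (snd c ` fst c) (\<lambda>x. vf_rep M c X x - vf_rep M c Y x)"
        using assms c chart_open[OF assms(1) c]
        by (intro Ck_on_diff) (auto simp: vector_fields_def smooth_on_def)
      show "vf_rep M c X x - vf_rep M c Y x = vf_rep M c (\<lambda>p. X p - Y p) x"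
        if "x \<in> snd c ` fst c" for x
        using linear_diff[OF linear_tcoord[OF assms(1) c chart_inv_in[OF assms(1) c that]]]
        by (simp add: vf_rep_def)
    qed
  qed
  with assms show ?thesis by (simp add: vector_fields_def)
qed

definition vf_fun :: "('a, 'e::euclidean_space) manifold \<Rightarrow> ('a \<Rightarrow> 'e) \<Rightarrow> ('a \<Rightarrow> real) \<Rightarrow> 'a \<Rightarrow> real" where
  "vf_fun M X f p =
     frechet_derivative (f \<circ> chart_inv (chart_at M p)) (at (snd (chart_at M p) p)) (X p)"

text \<open>\<open>[X,Y]\<^sup>i = X\<^sup>j \<partial>\<^sub>j Y\<^sup>i - Y\<^sup>j \<partial>\<^sub>j X\<^sup>i\<close>, evaluated at \<open>p\<close> in the chart \<open>chart_at M p\<close>, in which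
  the components of \<open>X\<close> and \<open>Y\<close> at \<open>p\<close> are \<open>X p\<close> and \<open>Y p\<close>; it corresponds to
  \<open>[X,Y]f = X(Yf) - Y(Xf)\<close>.\<close>

definition lie_bracket :: "('a, 'e::euclidean_space) manifold \<Rightarrow> ('a \<Rightarrow> 'e) \<Rightarrow> ('a \<Rightarrow> 'e) \<Rightarrow> 'a \<Rightarrow> 'e" where
  "lie_bracket M X Y p =
     (if p \<in> points M then
        (let c = chart_at M p; x = snd c p in
          frechet_derivative (vf_rep M c Y) (at x) (X p) - frechet_derivative (vf_rep M c X) (at x) (Y p))
      else 0)"


section \<open>Vector forms\<close>

text \<open>A vector form assigns to every point of \<open>M\<close> a (multi)linear map on the tangent space there; its values
  off \<open>M\<close> are irrelevant. It is smooth if its components in every chart are: the chart-\<open>c\<close> components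
  \<open>w\<close> are first turned into a tangent vector.\<close>

type_synonym ('a, 'e) form1 = "'a \<Rightarrow> 'e \<Rightarrow> 'e"
type_synonym ('a, 'e) form2 = "'a \<Rightarrow> 'e \<Rightarrow> 'e \<Rightarrow> 'e"

definition vector_1form :: "('a, 'e::euclidean_space) manifold \<Rightarrow> ('a, 'e) form1 \<Rightarrow> bool" where
  "vector_1form M K \<longleftrightarrow>
     (\<forall>p\<in>points M. linear (K p)) \<and>
     (\<forall>c\<in>Atlas M. \<forall>w. smooth_on (snd c ` fst c)
        (\<lambda>x. let p = chart_inv c x in tcoord M c p (K p (inv (tcoord M c p) w))))"

definition vector_2form :: "('a, 'e::euclidean_space) manifold \<Rightarrow> ('a, 'e) form2 \<Rightarrow> bool" where
  "vector_2form M B \<longleftrightarrow>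
     (\<forall>p\<in>points M. bilinear (B p) \<and> (\<forall>u v. B p u v = - B p v u)) \<and>
     (\<forall>c\<in>Atlas M. \<forall>w w'. smooth_on (snd c ` fst c)
        (\<lambda>x. let p = chart_inv c x in
           tcoord M c p (B p (inv (tcoord M c p) w) (inv (tcoord M c p) w'))))"

definition app1 :: "('a, 'e::euclidean_space) manifold \<Rightarrow> ('a, 'e) form1 \<Rightarrow> ('a \<Rightarrow> 'e) \<Rightarrow> 'a \<Rightarrow> 'e" where
  "app1 M K X p = (if p \<in> points M then K p (X p) else 0)"

definition app2 ::
    "('a, 'e::euclidean_space) manifold \<Rightarrow> ('a, 'e) form2 \<Rightarrow> ('a \<Rightarrow> 'e) \<Rightarrow> ('a \<Rightarrow> 'e) \<Rightarrow> 'a \<Rightarrow> 'e" where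
  "app2 M B X Y p = (if p \<in> points M then B p (X p) (Y p) else 0)"

text \<open>The Froelicher--Nijenhuis brackets \<open>[X,K]\<close> and \<open>[K,N]\<close> of a vector field \<open>X\<close> and vector 1-forms
  \<open>K\<close>, \<open>N\<close>, evaluated on vector fields.\<close>

definition fn_bracket01 ::
    "('a, 'e::euclidean_space) manifold \<Rightarrow> ('a \<Rightarrow> 'e) \<Rightarrow> ('a, 'e) form1 \<Rightarrow> ('a \<Rightarrow> 'e) \<Rightarrow> 'a \<Rightarrow> 'e" where
  "fn_bracket01 M X K Y p = lie_bracket M X (app1 M K Y) p - app1 M K (lie_bracket M X Y) p"

definition fn_bracket11 ::
    "('a, 'e::euclidean_space) manifold \<Rightarrow> ('a, 'e) form1 \<Rightarrow> ('a, 'e) form1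
      \<Rightarrow> ('a \<Rightarrow> 'e) \<Rightarrow> ('a \<Rightarrow> 'e) \<Rightarrow> 'a \<Rightarrow> 'e" where
  "fn_bracket11 M K N X Y p =
     lie_bracket M (app1 M K X) (app1 M N Y) p + lie_bracket M (app1 M N X) (app1 M K Y) p
     + app1 M K (app1 M N (lie_bracket M X Y)) p + app1 M N (app1 M K (lie_bracket M X Y)) p
     - app1 M K (lie_bracket M X (app1 M N Y)) p - app1 M K (lie_bracket M (app1 M N X) Y) p
     - app1 M N (lie_bracket M X (app1 M K Y)) p - app1 M N (lie_bracket M (app1 M K X) Y) p"


section \<open>The vertical endomorphism, the canonical field and L-connections\<close>

definition vertical_endomorphism ::
    "('a, 'e::euclidean_space) manifold \<Rightarrow> nat \<Rightarrow> ('a, 'e) form1 \<Rightarrow> bool" where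
  "vertical_endomorphism M n L \<longleftrightarrow>
     vector_1form M L \<and>
     (\<forall>z\<in>points M. dim (range (L z)) = n) \<and>
     (\<forall>X\<in>vector_fields M. \<forall>Y\<in>vector_fields M. fn_bracket11 M L L X Y = (\<lambda>_. 0)) \<and>
     (\<forall>z\<in>points M. range (L z) = {v. L z v = 0})"

definition vertical_space :: "('a, 'e) form1 \<Rightarrow> 'a \<Rightarrow> 'e set" where
  "vertical_space L z = range (L z)"

definition vertical_fields :: "('a, 'e::euclidean_space) manifold \<Rightarrow> ('a, 'e) form1 \<Rightarrow> ('a \<Rightarrow> 'e) set" where
  "vertical_fields M L = {X \<in> vector_fields M. \<forall>z\<in>points M. X z \<in> vertical_space L z}"

definition canonical_field ::
    "('a, 'e::euclidean_space) manifold \<Rightarrow> ('a, 'e) form1 \<Rightarrow> ('a \<Rightarrow> 'e) \<Rightarrow> bool" where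
  "canonical_field M L C \<longleftrightarrow>
     C \<in> vertical_fields M L \<and>
     (\<forall>Y\<in>vector_fields M. fn_bracket01 M C L Y = (\<lambda>p. - app1 M L Y p))"

definition semispray ::
    "('a, 'e::euclidean_space) manifold \<Rightarrow> ('a, 'e) form1 \<Rightarrow> ('a \<Rightarrow> 'e) \<Rightarrow> ('a \<Rightarrow> 'e) \<Rightarrow> bool" where
  "semispray M L C S \<longleftrightarrow> S \<in> vector_fields M \<and> app1 M L S = C"

definition semibasic2 :: "('a, 'e::euclidean_space) manifold \<Rightarrow> ('a, 'e) form1 \<Rightarrow> ('a, 'e) form2 \<Rightarrow> bool" where
  "semibasic2 M L B \<longleftrightarrow>
     (\<forall>z\<in>points M. \<forall>u v. L z (B z u v) = 0) \<and>
     (\<forall>X\<in>vertical_fields M L. \<forall>z\<in>points M. \<forall>v. B z (X z) v = 0)"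

text \<open>The potential \<open>i\<^sub>S B\<close> of a semibasic vector 2-form; it does not depend on the chosen semispray \<open>S\<close>
  (\<open>potential_eq\<close>).\<close>

definition potential ::
    "('a, 'e::euclidean_space) manifold \<Rightarrow> ('a, 'e) form1 \<Rightarrow> ('a \<Rightarrow> 'e) \<Rightarrow> ('a, 'e) form2 \<Rightarrow> ('a, 'e) form1" where
  "potential M L C B = (let S = (SOME S. semispray M L C S) in (\<lambda>z v. B z (S z) v))"

lemma potential_eq:
  assumes "smooth_manifold M" "vertical_endomorphism M n L" "vector_2form M B" "semibasic2 M L B"
    and S: "semispray M L C S" and z: "z \<in> points M"
  shows "potential M L C B z v = B z (S z) v"
proof -
  define S' where "S' = (SOME S. semispray M L C S)"
  have S': "semispray M L C S'" unfolding S'_def by (rule someI[of _ S]) (rule S)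
  have L0: "S' q - S q \<in> vertical_space L q" if q: "q \<in> points M" for q
  proof -
    have "app1 M L S' q = app1 M L S q" using S S' by (simp add: semispray_def)
    then have "L q (S' q) = L q (S q)" using q by (simp add: app1_def)
    moreover have "linear (L q)"
      using assms(2) q by (simp add: vertical_endomorphism_def vector_1form_def)
    ultimately have "L q (S' q - S q) = 0" by (simp add: linear_diff)
    then show ?thesis using assms(2) q by (simp add: vertical_endomorphism_def vertical_space_def)
  qed
  have "(\<lambda>p. S' p - S p) \<in> vertical_fields M L"
    using vector_fields_diff[OF assms(1), of S' S] S S' L0
    by (simp add: vertical_fields_def semispray_def)
  then have "\<forall>z\<in>points M. \<forall>v. B z (S' z - S z) v = 0"
    using assms(4) unfolding semibasic2_def by (elim conjE) (drule (1) bspec, simp)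
  then have "B z (S' z - S z) v = 0" using z by blast
  moreover have "bilinear (B z)" using assms(3) z by (simp add: vector_2form_def)
  ultimately have "B z (S' z) v = B z (S z) v" by (simp add: bilinear_lsub)
  then show ?thesis by (simp add: potential_def S'_def)
qed

definition L_connection ::
    "('a, 'e::euclidean_space) manifold \<Rightarrow> ('a, 'e) form1 \<Rightarrow> ('a, 'e) form1 \<Rightarrow> bool" where
  "L_connection M L \<Gamma> \<longleftrightarrow>
     vector_1form M \<Gamma> \<and>
     (\<forall>z\<in>points M. \<forall>v. L z (\<Gamma> z v) = L z v) \<and>
     (\<forall>z\<in>points M. \<forall>v. \<Gamma> z (L z v) = - L z v)"

definition horizontal_projector :: "('a, 'e::euclidean_space) form1 \<Rightarrow> ('a, 'e) form1" where
  "horizontal_projector \<Gamma> z v = (1/2) *\<^sub>R (v + \<Gamma> z v)"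


section \<open>Linear connections and L-lifts\<close>

text \<open>A linear connection is a function on pairs of vector fields, so as a HOL function it is fixed to be
  \<open>undefined\<close> elsewhere (\<open>\<rightarrow>\<^sub>E\<close>).\<close>

type_synonym ('a, 'e) connection = "('a \<Rightarrow> 'e) \<Rightarrow> ('a \<Rightarrow> 'e) \<Rightarrow> 'a \<Rightarrow> 'e"

definition linear_connection :: "('a, 'e::euclidean_space) manifold \<Rightarrow> ('a, 'e) connection \<Rightarrow> bool" where
  "linear_connection M D \<longleftrightarrow>
     D \<in> vector_fields M \<rightarrow>\<^sub>E vector_fields M \<rightarrow>\<^sub>E vector_fields M \<and>
     (\<forall>X\<in>vector_fields M. \<forall>X'\<in>vector_fields M. \<forall>Y\<in>vector_fields M.
        D (\<lambda>p. X p + X' p) Y = (\<lambda>p. D X Y p + D X' Y p)) \<and>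
     (\<forall>f\<in>smooth_functions M. \<forall>X\<in>vector_fields M. \<forall>Y\<in>vector_fields M.
        D (\<lambda>p. f p *\<^sub>R X p) Y = (\<lambda>p. f p *\<^sub>R D X Y p)) \<and>
     (\<forall>X\<in>vector_fields M. \<forall>Y\<in>vector_fields M. \<forall>Y'\<in>vector_fields M.
        D X (\<lambda>p. Y p + Y' p) = (\<lambda>p. D X Y p + D X Y' p)) \<and>
     (\<forall>f\<in>smooth_functions M. \<forall>X\<in>vector_fields M. \<forall>Y\<in>vector_fields M.
        D X (\<lambda>p. f p *\<^sub>R Y p) = (\<lambda>p. vf_fun M X f p *\<^sub>R Y p + f p *\<^sub>R D X Y p))"

definition torsion ::
    "('a, 'e::euclidean_space) manifold \<Rightarrow> ('a, 'e) connection \<Rightarrow> ('a \<Rightarrow> 'e) \<Rightarrow> ('a \<Rightarrow> 'e) \<Rightarrow> 'a \<Rightarrow> 'e" where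
  "torsion M D X Y p = D X Y p - D Y X p - lie_bracket M X Y p"

text \<open>\<open>DK = 0\<close> for a vector 1-form \<open>K\<close>.\<close>

definition parallel_1form ::
    "('a, 'e::euclidean_space) manifold \<Rightarrow> ('a, 'e) connection \<Rightarrow> ('a, 'e) form1 \<Rightarrow> bool" where
  "parallel_1form M D K \<longleftrightarrow>
     (\<forall>X\<in>vector_fields M. \<forall>Y\<in>vector_fields M. D X (app1 M K Y) = app1 M K (D X Y))"

definition L_almost_tangent ::
    "('a, 'e::euclidean_space) manifold \<Rightarrow> ('a, 'e) form1 \<Rightarrow> ('a, 'e) connection \<Rightarrow> bool" where
  "L_almost_tangent M L D \<longleftrightarrow> linear_connection M D \<and> parallel_1form M D L"

text \<open>\<open>K\<close> is the vector 1-form \<open>X \<mapsto> D\<^sub>X C\<close>, and it restricts to an isomorphism of the vertical bundle.\<close>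

definition regular_1form ::
    "('a, 'e::euclidean_space) manifold \<Rightarrow> ('a, 'e) form1 \<Rightarrow> ('a \<Rightarrow> 'e) \<Rightarrow> ('a, 'e) connection
      \<Rightarrow> ('a, 'e) form1 \<Rightarrow> bool" where
  "regular_1form M L C D K \<longleftrightarrow>
     vector_1form M K \<and> (\<forall>X\<in>vector_fields M. app1 M K X = D X C) \<and>
     (\<forall>z\<in>points M. bij_betw (K z) (vertical_space L z) (vertical_space L z))"

definition L_regular ::
    "('a, 'e::euclidean_space) manifold \<Rightarrow> ('a, 'e) form1 \<Rightarrow> ('a \<Rightarrow> 'e) \<Rightarrow> ('a, 'e) connection \<Rightarrow> bool" where
  "L_regular M L C D \<longleftrightarrow> L_almost_tangent M L D \<and> (\<exists>K. regular_1form M L C D K)"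

text \<open>\<open>\<Gamma> = I - 2 \<phi> \<circ> K\<close> with \<open>\<phi>\<close> the inverse of \<open>K\<close> on the vertical bundle. \<open>K\<close> is determined on \<open>M\<close> by
  \<open>D\<close>, because every tangent vector extends to a vector field.\<close>

definition induced_connection ::
    "('a, 'e::euclidean_space) manifold \<Rightarrow> ('a, 'e) form1 \<Rightarrow> ('a \<Rightarrow> 'e) \<Rightarrow> ('a, 'e) connection
      \<Rightarrow> ('a, 'e) form1 \<Rightarrow> bool" where
  "induced_connection M L C D \<Gamma> \<longleftrightarrow>
     (\<exists>K. regular_1form M L C D K \<and>
        (\<forall>z\<in>points M. \<forall>v. \<Gamma> z v = v - 2 *\<^sub>R inv_into (vertical_space L z) (K z) (K z v)))"

definition L_normal ::
    "('a, 'e::euclidean_space) manifold \<Rightarrow> ('a, 'e) form1 \<Rightarrow> ('a \<Rightarrow> 'e) \<Rightarrow> ('a, 'e) connection \<Rightarrow> bool" where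
  "L_normal M L C D \<longleftrightarrow>
     L_almost_tangent M L D \<and> (\<forall>X\<in>vector_fields M. D (app1 M L X) C = app1 M L X)"

definition L_lift ::
    "('a, 'e::euclidean_space) manifold \<Rightarrow> ('a, 'e) form1 \<Rightarrow> ('a \<Rightarrow> 'e) \<Rightarrow> ('a, 'e) form1
      \<Rightarrow> ('a, 'e) connection \<Rightarrow> bool" where
  "L_lift M L C \<Gamma> D \<longleftrightarrow> L_normal M L C D \<and> induced_connection M L C D \<Gamma>"

text \<open>\<open>D\<close> is reducible, where \<open>\<Gamma>\<close> is its induced L-connection.\<close>

definition L_reducible ::
    "('a, 'e::euclidean_space) manifold \<Rightarrow> ('a, 'e) form1 \<Rightarrow> ('a \<Rightarrow> 'e) \<Rightarrow> ('a, 'e) form1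
      \<Rightarrow> ('a, 'e) connection \<Rightarrow> bool" where
  "L_reducible M L C \<Gamma> D \<longleftrightarrow>
     L_regular M L C D \<and> induced_connection M L C D \<Gamma> \<and> parallel_1form M D \<Gamma>"

definition reducible_L_lift ::
    "('a, 'e::euclidean_space) manifold \<Rightarrow> ('a, 'e) form1 \<Rightarrow> ('a \<Rightarrow> 'e) \<Rightarrow> ('a, 'e) form1
      \<Rightarrow> ('a, 'e) connection \<Rightarrow> bool" where
  "reducible_L_lift M L C \<Gamma> D \<longleftrightarrow> L_lift M L C \<Gamma> D \<and> L_reducible M L C \<Gamma> D"

end

theory Submission
  imports Defs
begin

text \<open>
  Let \<open>v = (I - \<Gamma>)/2\<close> be the vertical projector and \<open>R\<close> the vector 1-form that inverts \<open>L\<close> from the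
  horizontal to the vertical bundle, so that \<open>R L = h\<close>, \<open>L R = v\<close>, \<open>R h = 0\<close>. Since \<open>h\<close> and \<open>L\<close> are to be
  parallel, the horizontal and vertical parts of \<open>T(LX, hY) = B(X, Y)\<close> read
  \<open>D\<^bsub>LX\<^esub> hY = h[LX, hY]\<close> and \<open>D\<^bsub>hY\<^esub> LX = v[hY, LX] - B(X, Y)\<close>;
  applying \<open>L\<close> to the first and \<open>R\<close> to the second gives the two remaining components of \<open>D\<close>.
  Hence \<open>D\<close> is unique, and necessarily
  \<open>D\<^sub>X Y = h[vX, hY] + L[vX, RY] + v[hX, vY] - B(RY, X) + R([hX, LY] - B(Y, X))\<close>.
  For this \<open>D\<close>, the equation \<open>T(LX, Y) = B(X, Y)\<close> follows from \<open>[L, L] = 0\<close>, the equation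
  \<open>D\<^bsub>LX\<^esub> C = LX\<close> from \<open>[C, L] = -L\<close>, and \<open>D\<^bsub>hX\<^esub> C = 0\<close> is the vertical part of
  \<open>B\<^sup>\<circ> + [C, h] = 0\<close>, because \<open>RC\<close> is a semispray.
\<close>

section \<open>Calculus of \<open>C\<^sup>k\<close> maps\<close>

lemma Ck_on_SucD: "Ck_on (Suc k) U f \<Longrightarrow> Ck_on k U f"
proof (induction k arbitrary: f)
  case 0
  then show ?case
    by (auto intro!: continuous_at_imp_continuous_on differentiable_imp_continuous_within)
next
  case (Suc k)
  from Suc.prems have "\<And>v. Ck_on k U (\<lambda>x. frechet_derivative f (at x) v)"
    by (intro Suc.IH) (simp only: Ck_on.simps(2)[of "Suc k"])
  with Suc.prems show ?case by simp
qed

text \<open>Uniqueness of derivatives lets an explicit \<open>f'\<close> stand in for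
  \<open>frechet_derivative\<close>, so each closure property below needs only its differentiation
  rule.\<close>

lemma Ck_on_SucI:
  assumes "open U" "\<And>x. x \<in> U \<Longrightarrow> (f has_derivative f' x) (at x)"
    and "\<And>v. Ck_on k U (\<lambda>x. f' x v)"
  shows "Ck_on (Suc k) U f"
proof -
  have e: "frechet_derivative f (at x) = f' x" if "x \<in> U" for x
    using frechet_derivative_at[OF assms(2)[OF that]] by simp
  have "Ck_on k U (\<lambda>x. frechet_derivative f (at x) v)" for v
    by (rule Ck_on_cong[OF assms(1) _ assms(3)[of v]]) (simp add: e)
  with assms(2) show ?thesis by (auto simp: differentiable_def)
qed

lemma Ck_on_has_derivative:
  "Ck_on (Suc k) U f \<Longrightarrow> x \<in> U \<Longrightarrow> (f has_derivative frechet_derivative f (at x)) (at x)"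
  by (simp add: frechet_derivative_works[symmetric])

lemma Ck_on_const: "open U \<Longrightarrow> Ck_on k U (\<lambda>_. c)"
proof (induction k arbitrary: c)
  case (Suc k)
  then show ?case by (intro Ck_on_SucI[where f'="\<lambda>_ _. 0"]) auto
qed simp

lemma Ck_on_add:
  assumes "open U" "Ck_on k U f" "Ck_on k U g"
  shows "Ck_on k U (\<lambda>x. f x + g x)"
  using assms
proof (induction k arbitrary: f g)
  case 0
  then show ?case by (auto intro: continuous_intros)
next
  case (Suc k)
  show ?case
  proof (rule Ck_on_SucI[OF \<open>open U\<close>])
    show "((\<lambda>x. f x + g x) has_derivative
        (\<lambda>v. frechet_derivative f (at x) v + frechet_derivative g (at x) v)) (at x)" if "x \<in> U" for x
      using Suc.prems that by (intro has_derivative_add Ck_on_has_derivative)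
  qed (use Suc in auto)
qed

lemma Ck_on_sum:
  assumes "open U" "\<And>i. i \<in> I \<Longrightarrow> Ck_on k U (f i)"
  shows "Ck_on k U (\<lambda>x. \<Sum>i\<in>I. f i x)"
  using assms(2)
  by (induction I rule: infinite_finite_induct) (auto intro: assms(1) Ck_on_add Ck_on_const)

text \<open>By the product rule the derivative is a sum of two bilinear terms, each pairing an
  undifferentiated factor with a derivative. The induction therefore uses \<open>Ck_on_SucD\<close>
  to lower the order of the undifferentiated factor.\<close>

lemma Ck_on_bounded_bilinear:
  assumes "bounded_bilinear B" "open U" "Ck_on k U f" "Ck_on k U g"
  shows "Ck_on k U (\<lambda>x. B (f x) (g x))"
  using assms
proof (induction k arbitrary: f g)
  case 0
  then show ?case by (auto intro: bounded_bilinear.continuous_on)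
next
  case (Suc k)
  show ?case
  proof (rule Ck_on_SucI[OF \<open>open U\<close>])
    show "((\<lambda>x. B (f x) (g x)) has_derivative
        (\<lambda>v. B (f x) (frechet_derivative g (at x) v) + B (frechet_derivative f (at x) v) (g x)))
        (at x)" if "x \<in> U" for x
      using Suc.prems that by (intro bounded_bilinear.FDERIV[OF assms(1)] Ck_on_has_derivative)
    show "Ck_on k U (\<lambda>x. B (f x) (frechet_derivative g (at x) v)
        + B (frechet_derivative f (at x) v) (g x))" for v
      using Suc.prems
      by (intro Ck_on_add Suc.IH Ck_on_SucD[OF Suc.prems(3)] Ck_on_SucD[OF Suc.prems(4)]) auto
  qed
qed

lemmas Ck_on_scaleR = Ck_on_bounded_bilinear[OF bounded_bilinear_scaleR]
lemmas Ck_on_inner = Ck_on_bounded_bilinear[OF bounded_bilinear_inner]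

lemma Ck_on_Pair:
  assumes "open U" "Ck_on k U f" "Ck_on k U g"
  shows "Ck_on k U (\<lambda>x. (f x, g x))"
  using assms
proof (induction k arbitrary: f g)
  case 0
  then show ?case by (auto intro: continuous_on_Pair)
next
  case (Suc k)
  show ?case
  proof (rule Ck_on_SucI[OF \<open>open U\<close>])
    show "((\<lambda>x. (f x, g x)) has_derivative
        (\<lambda>v. (frechet_derivative f (at x) v, frechet_derivative g (at x) v))) (at x)" if "x \<in> U" for x
      using Suc.prems that by (intro has_derivative_Pair Ck_on_has_derivative)
  qed (use Suc in auto)
qed

section \<open>Families of linear maps applied to a variable vector\<close>

lemma linear_euclidean_expand:
  fixes f :: "'e::euclidean_space \<Rightarrow> 'b::real_vector"
  assumes "linear f"
  shows "f v = (\<Sum>b\<in>Basis. (v \<bullet> b) *\<^sub>R f b)"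
proof -
  have "f v = f (\<Sum>b\<in>Basis. (v \<bullet> b) *\<^sub>R b)" by (simp add: euclidean_representation)
  also have "\<dots> = (\<Sum>b\<in>Basis. (v \<bullet> b) *\<^sub>R f b)"
    by (simp add: linear_sum[OF assms] linear_scale[OF assms])
  finally show ?thesis .
qed

text \<open>Expanding \<open>u x\<close> in the basis leaves a finite sum of scalar functions times
  the columns \<open>A x b\<close>, so regularity of \<open>A\<close> is asked for at fixed vectors
  only, as in the definition of vector forms.\<close>

lemma Ck_on_linear_apply:
  fixes A :: "'e::euclidean_space \<Rightarrow> 'f::euclidean_space \<Rightarrow> 'b::real_normed_vector"
  assumes "open U" "\<And>x. x \<in> U \<Longrightarrow> linear (A x)" "\<And>v. Ck_on k U (\<lambda>x. A x v)" "Ck_on k U u"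
  shows "Ck_on k U (\<lambda>x. A x (u x))"
proof (rule Ck_on_cong[OF assms(1)])
  show "Ck_on k U (\<lambda>x. \<Sum>b\<in>Basis. (u x \<bullet> b) *\<^sub>R A x b)"
    by (intro Ck_on_sum Ck_on_scaleR Ck_on_inner Ck_on_const assms)
  show "(\<Sum>b\<in>Basis. (u x \<bullet> b) *\<^sub>R A x b) = A x (u x)" if "x \<in> U" for x
    using linear_euclidean_expand[OF assms(2)[OF that]] by metis
qed

text \<open>Basis expansion turns this product rule into finitely many scalar ones, so
  \<open>A\<close> need only be differentiable at each fixed vector.\<close>

lemma has_derivative_linear_apply:
  fixes A :: "'d::real_normed_vector \<Rightarrow> 'e::euclidean_space \<Rightarrow> 'b::real_normed_vector"
  assumes U: "open U" "x \<in> U" and A: "\<And>y. y \<in> U \<Longrightarrow> linear (A y)"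
    and A': "\<And>v. ((\<lambda>y. A y v) has_derivative A' v) (at x)"
    and u: "(u has_derivative u') (at x)"
  shows "((\<lambda>y. A y (u y)) has_derivative (\<lambda>w. A' (u x) w + A x (u' w))) (at x)"
proof (rule has_derivative_transform_within_open[OF _ U])
  \<comment> \<open>Linearity of \<open>A' v w\<close> in \<open>v\<close> is inherited from that of
    \<open>A\<close> by uniqueness of the derivative.\<close>
  have l: "(\<Sum>b\<in>Basis. (v \<bullet> b) *\<^sub>R A' b w) = A' v w" for v w
  proof -
    have "((\<lambda>y. \<Sum>b\<in>Basis. (v \<bullet> b) *\<^sub>R A y b) has_derivative (\<lambda>w. \<Sum>b\<in>Basis. (v \<bullet> b) *\<^sub>R A' b w)) (at x)"
      by (auto intro!: derivative_eq_intros A')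
    then have "((\<lambda>y. A y v) has_derivative (\<lambda>w. \<Sum>b\<in>Basis. (v \<bullet> b) *\<^sub>R A' b w)) (at x)"
      by (rule has_derivative_transform_within_open[OF _ U])
        (use A linear_euclidean_expand in metis)
    then show ?thesis using has_derivative_unique[OF A'[of v]] by metis
  qed
  show "((\<lambda>y. \<Sum>b\<in>Basis. (u y \<bullet> b) *\<^sub>R A y b) has_derivative (\<lambda>w. A' (u x) w + A x (u' w))) (at x)"
    by (auto intro!: derivative_eq_intros A' u ext
        simp: l sum.distrib linear_euclidean_expand[OF A[OF U(2)], symmetric] add.commute)
  show "(\<Sum>b\<in>Basis. (u y \<bullet> b) *\<^sub>R A y b) = A y (u y)" if "y \<in> U" for y
    using linear_euclidean_expand[OF A[OF that]] by metis
qed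

text \<open>Since \<open>f\<close> vanishes at \<open>x\<close>, the term
  \<open>(g y - g x) *\<^sub>R f y\<close> is of smaller order than \<open>y - x\<close>, so
  continuity of \<open>g\<close> is enough. This serves to differentiate a solution \<open>u\<close>
  that is so far only known to be continuous.\<close>

lemma has_derivative_scaleR_vanishing:
  fixes f :: "'d::real_normed_vector \<Rightarrow> 'b::real_normed_vector"
  assumes g: "isCont g x" and f: "(f has_derivative f') (at x)" "f x = 0"
  shows "((\<lambda>y. g y *\<^sub>R f y) has_derivative (\<lambda>v. g x *\<^sub>R f' v)) (at x)"
proof -
  interpret bounded_linear f' using f by (simp add: has_derivative_def)
  obtain K where K: "\<And>v. norm (f' v) \<le> norm v * K" using bounded by blast
  have "((\<lambda>y. (g y - g x) *\<^sub>R f y) has_derivative (\<lambda>_. 0)) (at x)"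
    unfolding has_derivative_at_within
  proof (intro conjI)
    \<comment> \<open>\<open>?r\<close> is the remainder quotient of \<open>f\<close>. Together with
      the bounded quotient \<open>f' (y - x) /\<^sub>R norm (y - x)\<close> it adds up to
      \<open>f y /\<^sub>R norm (y - x)\<close>, and the factor \<open>g y - g x\<close> sends both
      parts to 0.\<close>
    let ?r = "\<lambda>y. (f y - f' (y - x)) /\<^sub>R norm (y - x)"
    have r: "(?r \<longlongrightarrow> 0) (at x)" using f by (simp add: has_derivative_at_within)
    have g0: "((\<lambda>y. g y - g x) \<longlongrightarrow> 0) (at x)"
      using g by (simp add: isCont_def LIM_zero)
    have "((\<lambda>y. (g y - g x) *\<^sub>R ?r y) \<longlongrightarrow> 0 *\<^sub>R 0) (at x)"
      by (intro tendsto_intros r g0)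
    moreover have "((\<lambda>y. (g y - g x) *\<^sub>R (f' (y - x) /\<^sub>R norm (y - x))) \<longlongrightarrow> 0) (at x)"
    proof (rule Lim_null_comparison)
      show "((\<lambda>y. norm (g y - g x) * K) \<longlongrightarrow> 0) (at x)"
        using tendsto_mult_left_zero[OF tendsto_norm_zero[OF g0]] .
      show "\<forall>\<^sub>F y in at x. norm ((g y - g x) *\<^sub>R (f' (y - x) /\<^sub>R norm (y - x))) \<le> norm (g y - g x) * K"
        unfolding eventually_at_filter
      proof (rule always_eventually, intro allI impI)
        fix y assume "y \<noteq> x"
        then have "norm (f' (y - x) /\<^sub>R norm (y - x)) \<le> K"
          using K[of "y - x"] by (simp add: field_simps)
        then show "norm ((g y - g x) *\<^sub>R (f' (y - x) /\<^sub>R norm (y - x))) \<le> norm (g y - g x) * K"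
          by (simp only: norm_scaleR real_norm_def mult_left_mono abs_ge_zero)
      qed
    qed
    ultimately have "((\<lambda>y. (g y - g x) *\<^sub>R ?r y + (g y - g x) *\<^sub>R (f' (y - x) /\<^sub>R norm (y - x))) \<longlongrightarrow> 0) (at x)"
      using tendsto_add by fastforce
    then show "((\<lambda>y. ((g y - g x) *\<^sub>R f y - (g x - g x) *\<^sub>R f x - 0) /\<^sub>R norm (y - x)) \<longlongrightarrow> 0) (at x)"
      by (simp flip: scaleR_add_right) (simp add: mult.commute)
  qed simp
  from has_derivative_add[OF this has_derivative_scaleR_right[OF f(1), of "g x"]]
  show ?thesis by (simp add: algebra_simps)
qed

section \<open>Regularity of solutions of injective linear systems\<close>

lemma linear_inj_bounded_left_inverse:
  fixes f :: "'a::euclidean_space \<Rightarrow> 'b::euclidean_space"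
  assumes "linear f" "inj f"
  obtains g where "bounded_linear g" "\<And>v. g (f v) = v"
  using linear_injective_left_inverse[OF assms] 
  by (metis comp_apply id_apply linear_conv_bounded_linear)

text \<open>With a left inverse \<open>g\<close> of \<open>A x\<close>, the equations give
  \<open>u y - u x = g (w y - w x - (A y - A x) (u y))\<close>. As \<open>A y\<close> tends to
  \<open>A x\<close>, the contribution of \<open>u y - u x\<close> on the right is absorbed into the
  left-hand side.\<close>

lemma continuous_on_linear_solution:
  fixes A :: "'d::real_normed_vector \<Rightarrow> 'e::euclidean_space \<Rightarrow> 'f::euclidean_space"
  assumes U: "open U" and A: "\<And>x. x \<in> U \<Longrightarrow> linear (A x)" "\<And>x. x \<in> U \<Longrightarrow> inj (A x)"
    and cA: "\<And>v. continuous_on U (\<lambda>x. A x v)" and w: "continuous_on U w"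
    and u: "\<And>x. x \<in> U \<Longrightarrow> A x (u x) = w x"
  shows "continuous_on U u"
proof (intro continuous_at_imp_continuous_on ballI)
  fix x assume x: "x \<in> U"
  obtain g where g: "bounded_linear g" "\<And>v. g (A x v) = v"
    using linear_inj_bounded_left_inverse[OF A(1)[OF x] A(2)[OF x]] by blast
  interpret g: bounded_linear g by (rule g(1))
  obtain K where K: "K > 0" "\<And>v. norm (g v) \<le> norm v * K"
    using g.pos_bounded by blast
  \<comment> \<open>\<open>e y\<close> bounds the norm of \<open>g\<close> composed with
    \<open>A y - A x\<close>, column by column. \<open>d\<close> is the bound left after the
    absorption, its factor 2 coming from \<open>e y < 1/2\<close>.\<close>
  define e where "e y = K * (\<Sum>b\<in>Basis. norm (A y b - A x b))" for y
  define d where "d y = 2 * (K * norm (w y - w x) + e y * norm (u x))" for y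
  have cw: "(w \<longlongrightarrow> w x) (at x)" and cA': "((\<lambda>y. A y b) \<longlongrightarrow> A x b) (at x)" for b
    using w cA x U by (simp_all add: continuous_on_eq_continuous_at[OF U] isCont_def)
  have "(e \<longlongrightarrow> K * (\<Sum>b\<in>(Basis::'e set). norm (A x b - A x b))) (at x)"
    unfolding e_def by (intro tendsto_intros cA')
  then have e0: "(e \<longlongrightarrow> 0) (at x)" by simp
  have "(d \<longlongrightarrow> 2 * (K * norm (w x - w x) + 0 * norm (u x))) (at x)"
    unfolding d_def by (intro tendsto_intros cw e0)
  then have d0: "(d \<longlongrightarrow> 0) (at x)" by simp
  have "\<forall>\<^sub>F y in at x. e y < 1/2" using e0 by (rule order_tendstoD) simp
  moreover have "\<forall>\<^sub>F y in at x. y \<in> U" using U x by (rule eventually_at_in_open')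
  ultimately have "\<forall>\<^sub>F y in at x. norm (u y - u x) \<le> d y"
  proof eventually_elim
    case (elim y)
    have s: "(A y - A x) (u y) = (\<Sum>b\<in>Basis. (u y \<bullet> b) *\<^sub>R (A y b - A x b))"
      using linear_euclidean_expand[OF A(1)[OF elim(2)], of "u y"]
        linear_euclidean_expand[OF A(1)[OF x], of "u y"]
      by (simp add: scaleR_diff_right sum_subtractf)
    have "norm ((A y - A x) (u y)) \<le> (\<Sum>b\<in>Basis. norm (u y) * norm (A y b - A x b))"
      unfolding s by (rule sum_norm_le) (simp add: Basis_le_norm mult_right_mono)
    then have n: "K * norm ((A y - A x) (u y)) \<le> e y * norm (u y)"
      using mult_left_mono[OF _ less_imp_le[OF K(1)]]
      by (fastforce simp: e_def sum_distrib_left[symmetric] mult_ac)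
    have eq: "w y - w x - (A y - A x) (u y) = A x (u y) - A x (u x)"
      by (simp add: u[OF elim(2)] u[OF x])
    have "u y - u x = g (w y - w x - (A y - A x) (u y))" by (simp only: eq g.diff g(2))
    then have "norm (u y - u x) \<le> norm (w y - w x - (A y - A x) (u y)) * K"
      using K(2)[of "w y - w x - (A y - A x) (u y)"] by (simp only:)
    also have "\<dots> \<le> (norm (w y - w x) + norm ((A y - A x) (u y))) * K"
      using K(1) by (intro mult_right_mono norm_triangle_ineq4) auto
    also have "\<dots> \<le> K * norm (w y - w x) + e y * norm (u y)" using n by (simp add: algebra_simps)
    also have "\<dots> \<le> K * norm (w y - w x) + e y * (norm (u x) + norm (u y - u x))"
      using K(1) norm_triangle_sub[of "u y" "u x"]
      by (intro add_left_mono mult_left_mono) (auto simp: e_def sum_nonneg)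
    also have "\<dots> \<le> K * norm (w y - w x) + e y * norm (u x) + 1/2 * norm (u y - u x)"
      using mult_right_mono[of "e y" "1/2" "norm (u y - u x)"] elim(1) by (simp add: algebra_simps)
    finally show ?case by (simp add: d_def)
  qed
  from Lim_null_comparison[OF this d0] show "isCont u x"
    unfolding isCont_def by (rule LIM_zero_cancel)
qed

text \<open>On \<open>U\<close> one has \<open>u y = g (w y - (A y - A x) (u y))\<close> with
  \<open>g\<close> a left inverse of \<open>A x\<close>. The columns \<open>A y b - A x b\<close>
  vanish at \<open>x\<close>, so continuity of \<open>u\<close> makes the right-hand side
  differentiable there.\<close>

lemma has_derivative_linear_solution:
  fixes A :: "'d::real_normed_vector \<Rightarrow> 'e::euclidean_space \<Rightarrow> 'f::euclidean_space"
  assumes U: "open U" "x \<in> U" and A: "\<And>y. y \<in> U \<Longrightarrow> linear (A y)" "inj (A x)"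
    and A': "\<And>v. ((\<lambda>y. A y v) has_derivative A' v) (at x)"
    and w: "(w has_derivative w') (at x)"
    and u: "\<And>y. y \<in> U \<Longrightarrow> A y (u y) = w y" and cu: "isCont u x"
  obtains u' where "(u has_derivative u') (at x)" "\<And>v. A x (u' v) = w' v - A' (u x) v"
proof -
  obtain g where g: "bounded_linear g" "\<And>v. g (A x v) = v"
    using linear_inj_bounded_left_inverse[OF A(1)[OF U(2)] A(2)] by blast
  let ?r = "\<lambda>y. \<Sum>b\<in>Basis. (u y \<bullet> b) *\<^sub>R (A y b - A x b)"
  let ?u' = "\<lambda>v. g (w' v - (\<Sum>b\<in>Basis. (u x \<bullet> b) *\<^sub>R A' b v))"
  have "(?r has_derivative (\<lambda>v. \<Sum>b\<in>Basis. (u x \<bullet> b) *\<^sub>R A' b v)) (at x)"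
  proof (intro has_derivative_sum has_derivative_scaleR_vanishing)
    show "((\<lambda>y. A y b - A x b) has_derivative A' b) (at x)" for b
      using has_derivative_diff[OF A'[of b] has_derivative_const] by simp
  qed (use cu in \<open>auto intro: continuous_intros\<close>)
  then have "((\<lambda>y. g (w y - ?r y)) has_derivative ?u') (at x)"
    by (intro bounded_linear.has_derivative[OF g(1)] has_derivative_diff w)
  then have d: "(u has_derivative ?u') (at x)"
  proof (rule has_derivative_transform_within_open[OF _ U])
    fix y assume y: "y \<in> U"
    have "?r y = A y (u y) - A x (u y)"
      using linear_euclidean_expand[OF A(1)[OF y], of "u y"]
        linear_euclidean_expand[OF A(1)[OF U(2)], of "u y"]
      by (simp add: scaleR_diff_right sum_subtractf)
    then show "g (w y - ?r y) = u y" using g u[OF y] by simp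
  qed
  have "((\<lambda>y. A y (u y)) has_derivative (\<lambda>v. A' (u x) v + A x (?u' v))) (at x)"
    by (rule has_derivative_linear_apply[OF U A(1) A' d])
  then have "(w has_derivative (\<lambda>v. A' (u x) v + A x (?u' v))) (at x)"
    by (rule has_derivative_transform_within_open[OF _ U]) (rule u)
  from fun_cong[OF has_derivative_unique[OF w this]]
  have "w' v = A' (u x) v + A x (?u' v)" for v .
  then have "A x (?u' v) = w' v - A' (u x) v" for v
    unfolding eq_diff_eq by (metis add.commute)
  with d show ?thesis by (rule that)
qed

text \<open>The derivative of the solution of \<open>A u = w\<close> solves a linear system with the same matrix \<open>A\<close>,
  so that smoothness follows by induction without inverting matrices.\<close>

lemma Ck_on_linear_solution:
  fixes A :: "'d::euclidean_space \<Rightarrow> 'e::euclidean_space \<Rightarrow> 'f::euclidean_space"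
  assumes "open U" "\<And>x. x \<in> U \<Longrightarrow> linear (A x)" "\<And>x. x \<in> U \<Longrightarrow> inj (A x)"
    and "\<And>v. Ck_on k U (\<lambda>x. A x v)" "Ck_on k U w" "\<And>x. x \<in> U \<Longrightarrow> A x (u x) = w x"
  shows "Ck_on k U u"
  using assms
proof (induction k arbitrary: u w)
  case 0
  then show ?case using continuous_on_linear_solution[of U A w u] by simp
next
  case (Suc k)
  note U = \<open>open U\<close> and lA = Suc.prems(2) and iA = Suc.prems(3) and cA = Suc.prems(4)
  \<comment> \<open>The derivative of \<open>u\<close> solves a system whose right-hand side
    contains \<open>u\<close> itself, so \<open>u\<close> must first be known to be of class
    \<open>k\<close>.\<close>
  have uk: "Ck_on k U u"
    by (rule Suc.IH[OF U lA iA Ck_on_SucD[OF cA] Ck_on_SucD[OF Suc.prems(5)] Suc.prems(6)])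
  have "Ck_on 0 U u"
    using Suc.prems by (intro continuous_on_linear_solution[of U A w u, folded Ck_on.simps(1)])
      (auto intro!: continuous_at_imp_continuous_on differentiable_imp_continuous_within)
  then have cu: "isCont u x" if "x \<in> U" for x
    using that U by (simp add: continuous_on_eq_continuous_at)
  let ?A' = "\<lambda>x v. frechet_derivative (\<lambda>y. A y v) (at x)"
  have ex: "\<exists>u'. (u has_derivative u') (at x) \<and>
      (\<forall>v. A x (u' v) = frechet_derivative w (at x) v - ?A' x (u x) v)" if x: "x \<in> U" for x
    by (rule has_derivative_linear_solution[OF U x lA iA[OF x] Ck_on_has_derivative[OF cA x]
          Ck_on_has_derivative[OF Suc.prems(5) x] Suc.prems(6) cu[OF x]]) blast+
  define u' where "u' x = frechet_derivative u (at x)" for x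
  have u': "(u has_derivative u' x) (at x)"
      "\<And>v. A x (u' x v) = frechet_derivative w (at x) v - ?A' x (u x) v" if x: "x \<in> U" for x
  proof -
    from ex[OF x] obtain t where t: "(u has_derivative t) (at x)"
      "\<And>v. A x (t v) = frechet_derivative w (at x) v - ?A' x (u x) v" by blast
    with frechet_derivative_at[OF t(1)] show "(u has_derivative u' x) (at x)"
      "\<And>v. A x (u' x v) = frechet_derivative w (at x) v - ?A' x (u x) v" by (simp_all add: u'_def)
  qed
  \<comment> \<open>Uniqueness of derivatives again transfers linearity in \<open>v\<close> from
    \<open>A\<close> to its derivative, as \<open>Ck_on_linear_apply\<close> requires for the new
    right-hand side.\<close>
  have lA': "linear (\<lambda>v. ?A' x v t)" if x: "x \<in> U" for x t
  proof (rule linearI)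
    show "?A' x (v + v') t = ?A' x v t + ?A' x v' t" for v v'
    proof -
      have "((\<lambda>y. A y (v + v')) has_derivative (\<lambda>t. ?A' x v t + ?A' x v' t)) (at x)"
        by (rule has_derivative_transform_within_open[OF has_derivative_add[OF
                Ck_on_has_derivative[OF cA x] Ck_on_has_derivative[OF cA x]] U x])
          (simp add: linear_add[OF lA])
      from frechet_derivative_at[OF this] show ?thesis by metis
    qed
    show "?A' x (c *\<^sub>R v) t = c *\<^sub>R ?A' x v t" for c v
    proof -
      have "((\<lambda>y. A y (c *\<^sub>R v)) has_derivative (\<lambda>t. c *\<^sub>R ?A' x v t)) (at x)"
        by (rule has_derivative_transform_within_open[OF has_derivative_scaleR_right[OF
                Ck_on_has_derivative[OF cA x]] U x])
          (simp add: linear_scale[OF lA])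
      from frechet_derivative_at[OF this] show ?thesis by metis
    qed
  qed
  show ?case
  proof (rule Ck_on_SucI[OF U u'(1)])
    show "Ck_on k U (\<lambda>x. u' x t)" for t
    proof (rule Suc.IH[OF U lA iA])
      show "Ck_on k U (\<lambda>x. A x v)" for v using cA by (rule Ck_on_SucD)
      have dA: "Ck_on k U (\<lambda>x. ?A' x v t)" for v using cA[of v] by simp
      have dw: "Ck_on k U (\<lambda>x. frechet_derivative w (at x) t)" using Suc.prems(5) by simp
      show "Ck_on k U (\<lambda>x. frechet_derivative w (at x) t - ?A' x (u x) t)"
        by (rule Ck_on_diff[OF U dw Ck_on_linear_apply[OF U lA' dA uk]])
    qed (simp_all add: u'(2))
  qed
qed

text \<open>The mean value theorem is applied twice: along \<open>v\<close> to the increment of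
  \<open>f\<close> in direction \<open>s *\<^sub>R w\<close>, then along \<open>w\<close> to the
  derivative of \<open>f\<close> in direction \<open>v\<close>.\<close>

lemma second_difference_mean_value:
  fixes f :: "'e::euclidean_space \<Rightarrow> real"
  assumes f: "Ck_on 2 U f" and r: "ball x r \<subseteq> U" and s: "0 < s" "s * (norm v + norm w) < r"
  obtains y where "y \<in> ball x r"
    "f (x + s *\<^sub>R v + s *\<^sub>R w) - f (x + s *\<^sub>R v) - f (x + s *\<^sub>R w) + f x =
      s * s * frechet_derivative (\<lambda>y. frechet_derivative f (at y) v) (at y) w"
proof -
  have in_ball: "x + a *\<^sub>R v + b *\<^sub>R w \<in> ball x r" if "0 \<le> a" "a \<le> s" "0 \<le> b" "b \<le> s" for a b
  proof -
    have "norm (a *\<^sub>R v + b *\<^sub>R w) \<le> a * norm v + b * norm w"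
      using that norm_triangle_ineq[of "a *\<^sub>R v" "b *\<^sub>R w"] by simp
    also have "\<dots> \<le> s * (norm v + norm w)"
      unfolding distrib_left using that by (intro add_mono mult_right_mono) auto
    finally show ?thesis using s norm_minus_cancel[of "a *\<^sub>R v + b *\<^sub>R w"] by (simp add: dist_norm algebra_simps)
  qed
  define g where "g y = frechet_derivative f (at y) v" for y
  have f2: "Ck_on (Suc (Suc 0)) U f" using f by (simp add: numeral_2_eq_2)
  then have g1: "Ck_on (Suc 0) U g" by (simp add: g_def[abs_def])
  note df = Ck_on_has_derivative[OF f2 subsetD[OF r]] and dg = Ck_on_has_derivative[OF g1 subsetD[OF r]]
  let ?p = "\<lambda>a. f (x + a *\<^sub>R v + s *\<^sub>R w) - f (x + a *\<^sub>R v)"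
  have "\<exists>a\<in>{0<..<s}. ?p s - ?p 0 = (\<lambda>t. t * (g (x + a *\<^sub>R v + s *\<^sub>R w) - g (x + a *\<^sub>R v))) (s - 0)"
  proof (rule mvt_simple[OF s(1)])
    fix a assume a: "0 \<le> a" "a \<le> s"
    have *: "((\<lambda>a. f (x + a *\<^sub>R v + b *\<^sub>R w)) has_derivative (\<lambda>t. t * g (x + a *\<^sub>R v + b *\<^sub>R w)))
        (at a within {0..s})" if b: "0 \<le> b" "b \<le> s" for b
    proof -
      have l: "linear (frechet_derivative f (at (x + a *\<^sub>R v + b *\<^sub>R w)))"
        using df[OF in_ball[OF a b]] by (rule has_derivative_linear)
      have "((\<lambda>a. f (x + a *\<^sub>R v + b *\<^sub>R w)) has_derivative
          (\<lambda>t. frechet_derivative f (at (x + a *\<^sub>R v + b *\<^sub>R w)) (t *\<^sub>R v))) (at a within {0..s})"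
        by (rule has_derivative_compose[of "\<lambda>a. x + a *\<^sub>R v + b *\<^sub>R w", OF _ df[OF in_ball[OF a b]]])
          (auto intro!: derivative_eq_intros)
      then show ?thesis by (simp add: linear_scale[OF l] g_def)
    qed
    from has_derivative_diff[OF *[of s] *[of 0]] s
    show "(?p has_derivative (\<lambda>t. t * (g (x + a *\<^sub>R v + s *\<^sub>R w) - g (x + a *\<^sub>R v)))) (at a within {0..s})"
      by (simp add: algebra_simps)
  qed
  then obtain a where a: "0 < a" "a < s"
    "?p s - ?p 0 = s * (g (x + a *\<^sub>R v + s *\<^sub>R w) - g (x + a *\<^sub>R v))" by auto
  let ?q = "\<lambda>b. g (x + a *\<^sub>R v + b *\<^sub>R w)"
  have "\<exists>b\<in>{0<..<s}. ?q s - ?q 0 = (\<lambda>t. t * frechet_derivative g (at (x + a *\<^sub>R v + b *\<^sub>R w)) w) (s - 0)"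
  proof (rule mvt_simple[OF s(1)])
    fix b assume b: "0 \<le> b" "b \<le> s"
    have i: "x + a *\<^sub>R v + b *\<^sub>R w \<in> ball x r" using a b by (intro in_ball) auto
    have l: "linear (frechet_derivative g (at (x + a *\<^sub>R v + b *\<^sub>R w)))"
      using dg[OF i] by (rule has_derivative_linear)
    have "(?q has_derivative
        (\<lambda>t. frechet_derivative g (at (x + a *\<^sub>R v + b *\<^sub>R w)) (t *\<^sub>R w))) (at b within {0..s})"
      by (rule has_derivative_compose[of "\<lambda>b. x + a *\<^sub>R v + b *\<^sub>R w", OF _ dg[OF i]])
        (auto intro!: derivative_eq_intros)
    then show "(?q has_derivative
        (\<lambda>t. t * frechet_derivative g (at (x + a *\<^sub>R v + b *\<^sub>R w)) w)) (at b within {0..s})"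
      by (simp add: linear_scale[OF l])
  qed
  then obtain b where b: "0 < b" "b < s"
    "?q s - ?q 0 = s * frechet_derivative g (at (x + a *\<^sub>R v + b *\<^sub>R w)) w" by auto
  show ?thesis
  proof (rule that)
    show "x + a *\<^sub>R v + b *\<^sub>R w \<in> ball x r" using a b by (intro in_ball) auto
    show "f (x + s *\<^sub>R v + s *\<^sub>R w) - f (x + s *\<^sub>R v) - f (x + s *\<^sub>R w) + f x =
        s * s * frechet_derivative (\<lambda>y. frechet_derivative f (at y) v) (at (x + a *\<^sub>R v + b *\<^sub>R w)) w"
      using a(3) b(3) by (simp add: g_def[abs_def])
  qed
qed

text \<open>The second difference on the left of \<open>second_difference_mean_value\<close> is symmetric in \<open>v\<close> and \<open>w\<close>.\<close>

lemma symmetric_second_derivative_real: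
  fixes f :: "'e::euclidean_space \<Rightarrow> real"
  assumes U: "open U" "x \<in> U" and f: "Ck_on 2 U f"
  shows "frechet_derivative (\<lambda>y. frechet_derivative f (at y) v) (at x) w =
    frechet_derivative (\<lambda>y. frechet_derivative f (at y) w) (at x) v"
proof (rule ccontr)
  define h where "h v w y = frechet_derivative (\<lambda>y. frechet_derivative f (at y) v) (at y) w" for v w y
  assume "\<not> ?thesis"
  \<comment> \<open>Half the gap is the right tolerance: at \<open>y\<close> and \<open>z\<close>
    below the two mixed derivatives agree, and each is less than half the gap away from its value at
    \<open>x\<close>.\<close>
  then have e: "dist (h v w x) (h w v x) / 2 > 0" by (simp add: h_def)
  have "continuous_on U (h v w)" for v w
    using f by (simp add: numeral_2_eq_2 h_def[abs_def])
  then have c: "isCont (h v w) x" for v w using U by (simp add: continuous_on_eq_continuous_at)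
  from U obtain r0 where r0: "r0 > 0" "ball x r0 \<subseteq> U" by (meson openE)
  obtain r1 where r1: "r1 > 0"
    "\<And>y. dist y x < r1 \<Longrightarrow> dist (h v w y) (h v w x) < dist (h v w x) (h w v x) / 2"
    using c[of v w, unfolded continuous_at_eps_delta, rule_format, OF e] by blast
  obtain r2 where r2: "r2 > 0"
    "\<And>y. dist y x < r2 \<Longrightarrow> dist (h w v y) (h w v x) < dist (h v w x) (h w v x) / 2"
    using c[of w v, unfolded continuous_at_eps_delta, rule_format, OF e] by blast
  define r where "r = min r0 (min r1 r2)"
  \<comment> \<open>The parallelogram spanned by \<open>s *\<^sub>R v\<close> and
    \<open>s *\<^sub>R w\<close> fits in the ball; the added 1 keeps the denominator positive when
    both vectors are 0.\<close>
  define s where "s = r / (norm v + norm w + 1)"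
  have r: "r > 0" "ball x r \<subseteq> U" "r \<le> r1" "r \<le> r2" using r0 r1 r2 by (auto simp: r_def)
  have n: "norm v + norm w + 1 > 0" by (intro add_nonneg_pos) auto
  then have s: "s > 0" "s * (norm v + norm w) < r" using r(1) by (auto simp: s_def field_simps)
  then have s': "s * (norm w + norm v) < r" by (simp add: add.commute)
  obtain y where y: "y \<in> ball x r" "f (x + s *\<^sub>R v + s *\<^sub>R w) - f (x + s *\<^sub>R v) - f (x + s *\<^sub>R w) + f x = s * s * h v w y"
    using second_difference_mean_value[OF f r(2) s] unfolding h_def by blast
  obtain z where z: "z \<in> ball x r" "f (x + s *\<^sub>R w + s *\<^sub>R v) - f (x + s *\<^sub>R w) - f (x + s *\<^sub>R v) + f x = s * s * h w v z"
    using second_difference_mean_value[OF f r(2) s(1) s'] unfolding h_def by blast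
  have "x + s *\<^sub>R v + s *\<^sub>R w = x + s *\<^sub>R w + s *\<^sub>R v" by simp
  with y(2) z(2) have "s * s * h v w y = s * s * h w v z" by (smt (verit))
  then have "h v w y = h w v z" using s by simp
  have "dist y x < r1" "dist z x < r2" using y(1) z(1) r by (auto simp: dist_commute)
  then have "dist (h v w y) (h v w x) < dist (h v w x) (h w v x) / 2"
      "dist (h w v z) (h w v x) < dist (h v w x) (h w v x) / 2"
    by (blast intro: r1(2) r2(2))+
  with \<open>h v w y = h w v z\<close> show False by (metis dist_commute dist_triangle_half_r less_irrefl)
qed

text \<open>Pairing with a basis vector commutes with both derivatives and reduces the claim to the
  real case. \<open>e1\<close> is stated on all of \<open>U\<close> because its two sides are
  differentiated once more in \<open>e2\<close>.\<close>

lemma symmetric_second_derivative: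
  fixes f :: "'e::euclidean_space \<Rightarrow> 'f::euclidean_space"
  assumes U: "open U" "x \<in> U" and f: "Ck_on 2 U f"
  shows "frechet_derivative (\<lambda>y. frechet_derivative f (at y) v) (at x) w =
    frechet_derivative (\<lambda>y. frechet_derivative f (at y) w) (at x) v"
proof (rule euclidean_eqI)
  fix b :: 'f
  let ?d = "\<lambda>v y. frechet_derivative f (at y) v"
  have f2: "Ck_on (Suc (Suc 0)) U f" using f by (simp add: numeral_2_eq_2)
  have e1: "frechet_derivative (\<lambda>y. f y \<bullet> b) (at y) v = ?d v y \<bullet> b" if y: "y \<in> U" for y v
  proof -
    have "((\<lambda>y. f y \<bullet> b) has_derivative (\<lambda>v. ?d v y \<bullet> b)) (at y)"
      by (intro has_derivative_inner_left Ck_on_has_derivative[OF f2 y])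
    from frechet_derivative_at[OF this] show ?thesis by metis
  qed
  have e2: "frechet_derivative (\<lambda>y. frechet_derivative (\<lambda>y. f y \<bullet> b) (at y) v) (at x) w
      = frechet_derivative (?d v) (at x) w \<bullet> b" for v w
  proof -
    have "Ck_on (Suc 0) U (?d v)" using f2 by simp
    then have "((\<lambda>y. ?d v y \<bullet> b) has_derivative (\<lambda>w. frechet_derivative (?d v) (at x) w \<bullet> b)) (at x)"
      using U(2) by (intro has_derivative_inner_left Ck_on_has_derivative)
    then have "((\<lambda>y. frechet_derivative (\<lambda>y. f y \<bullet> b) (at y) v) has_derivative
        (\<lambda>w. frechet_derivative (?d v) (at x) w \<bullet> b)) (at x)"
      by (rule has_derivative_transform_within_open[OF _ U]) (simp add: e1)
    from frechet_derivative_at[OF this] show ?thesis by metis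
  qed
  have "Ck_on 2 U (\<lambda>y. f y \<bullet> b)" using f U by (intro Ck_on_inner Ck_on_const)
  from symmetric_second_derivative_real[OF U this, of v w]
  show "frechet_derivative (?d v) (at x) w \<bullet> b = frechet_derivative (?d w) (at x) v \<bullet> b"
    by (simp add: e2)
qed


section \<open>Vector fields and their Lie bracket\<close>

locale smooth_mfd =
  fixes M :: "('a, 'e::euclidean_space) manifold"
  assumes smooth: "smooth_manifold M"
begin

abbreviation VF :: "('a \<Rightarrow> 'e) set" where "VF \<equiv> vector_fields M"

section \<open>Charts and the change of components of tangent vectors\<close>

lemma chart_image_open:
  assumes "c \<in> Atlas M" "openin (Top M) V" "V \<subseteq> fst c"
  shows "open (snd c ` V)"
proof -
  have c: "is_chart (Top M) c" using assms smooth by (simp add: smooth_manifold_def)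
  then have "open_map (subtopology (Top M) (fst c)) (top_of_set (snd c ` fst c)) (snd c)"
    by (simp add: is_chart_def homeomorphic_imp_open_map)
  moreover have "openin (subtopology (Top M) (fst c)) V"
    using assms(2,3) by (auto simp: openin_subtopology)
  ultimately have "openin (top_of_set (snd c ` fst c)) (snd c ` V)" by (simp add: open_map_def)
  then show ?thesis using c by (auto simp: is_chart_def dest: openin_open_trans)
qed

lemma openin_chart: "c \<in> Atlas M \<Longrightarrow> openin (Top M) (fst c)"
  using smooth by (simp add: smooth_manifold_def is_chart_def)

lemma overlap_open: "c \<in> Atlas M \<Longrightarrow> d \<in> Atlas M \<Longrightarrow> open (snd d ` (fst d \<inter> fst c))"
  by (intro chart_image_open openin_Int openin_chart) auto

lemma Ck_on_transition:
  "c \<in> Atlas M \<Longrightarrow> d \<in> Atlas M \<Longrightarrow> Ck_on k (snd d ` (fst d \<inter> fst c)) (transition d c)"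
  using smooth by (simp add: smooth_manifold_def smooth_on_def)

lemma transition_apply: "d \<in> Atlas M \<Longrightarrow> q \<in> fst d \<Longrightarrow> transition d c (snd d q) = snd c q"
  by (simp add: transition_def chart_inv_left[OF smooth])

lemma transition_has_derivative:
  assumes "c \<in> Atlas M" "d \<in> Atlas M" "q \<in> fst c" "q \<in> fst d"
  shows "(transition d c has_derivative frechet_derivative (transition d c) (at (snd d q))) (at (snd d q))"
  by (rule Ck_on_has_derivative[OF Ck_on_transition[OF assms(1,2)]]) (use assms in auto)

text \<open>The chain rule for passing from \<open>chart_at M q\<close> through \<open>d\<close> to
  \<open>c\<close>; the transition map factors in this way on the triple overlap.\<close>

lemma tcoord_cocycle:
  assumes "c \<in> Atlas M" "d \<in> Atlas M" "q \<in> fst c" "q \<in> fst d"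
  shows "tcoord M c q v = frechet_derivative (transition d c) (at (snd d q)) (tcoord M d q v)"
proof -
  define e where "e = chart_at M q"
  have q: "q \<in> points M" using chart_dom[OF smooth assms(1)] assms(3) by blast
  have e: "e \<in> Atlas M" "q \<in> fst e" using chart_at[OF smooth q] by (simp_all add: e_def)
  let ?W = "snd e ` (fst e \<inter> fst d \<inter> fst c)"
  have W: "open ?W" "snd e q \<in> ?W"
    using assms e by (auto intro!: chart_image_open openin_Int openin_chart)
  have ed: "(transition e d has_derivative tcoord M d q) (at (snd e q))"
    using transition_has_derivative[OF assms(2) e(1) assms(4) e(2)] by (simp add: tcoord_def e_def)
  have dc: "(transition d c has_derivative frechet_derivative (transition d c) (at (snd d q)))
      (at (transition e d (snd e q)))"
    using transition_has_derivative[OF assms] transition_apply[OF e] by simp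
  have "(transition e c has_derivative (\<lambda>v. frechet_derivative (transition d c) (at (snd d q)) (tcoord M d q v)))
      (at (snd e q))"
    by (rule has_derivative_transform_within_open[OF has_derivative_compose[OF ed dc] W])
      (use e assms in \<open>auto simp: transition_apply\<close>)
  from frechet_derivative_at[OF this] show ?thesis by (simp add: tcoord_def e_def fun_eq_iff)
qed

text \<open>Injectivity: returning to \<open>chart_at M q\<close> by the cocycle gives the identity.
  Surjectivity follows because domain and target are the same finite-dimensional space.\<close>

lemma
  assumes "c \<in> Atlas M" "q \<in> fst c"
  shows bij_tcoord: "bij (tcoord M c q)"
    and inv_tcoord_left: "inv (tcoord M c q) (tcoord M c q v) = v"
    and inv_tcoord_right: "tcoord M c q (inv (tcoord M c q) w) = w"
    and linear_inv_tcoord: "linear (inv (tcoord M c q))"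
proof -
  have q: "q \<in> points M" using chart_dom[OF smooth assms(1)] assms(2) by blast
  note e = chart_at[OF smooth q]
  have lin: "linear (tcoord M c q)" by (rule linear_tcoord[OF smooth assms])
  have inj: "inj (tcoord M c q)"
  proof (rule injI)
    fix v w assume "tcoord M c q v = tcoord M c q w"
    then have "tcoord M (chart_at M q) q v = tcoord M (chart_at M q) q w"
      using tcoord_cocycle[OF e(1) assms(1) e(2) assms(2)] by simp
    then show "v = w" by (simp add: tcoord_chart_at[OF smooth q])
  qed
  then show bij: "bij (tcoord M c q)"
    using linear_injective_imp_surjective[OF lin] by (simp add: bij_def)
  show "inv (tcoord M c q) (tcoord M c q v) = v" using inj by simp
  show "tcoord M c q (inv (tcoord M c q) w) = w"
    using bij by (simp add: bij_is_surj surj_f_inv_f)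
  show "linear (inv (tcoord M c q))"
    by (rule inj_linear_imp_inv_linear[OF lin inj])
qed

section \<open>Smoothness of vector fields in charts\<close>

lemma Ck_on_vf_rep: "X \<in> VF \<Longrightarrow> c \<in> Atlas M \<Longrightarrow> Ck_on k (snd c ` fst c) (vf_rep M c X)"
  by (simp add: vector_fields_def smooth_on_def)

lemma vf_rep_has_derivative:
  "X \<in> VF \<Longrightarrow> c \<in> Atlas M \<Longrightarrow> p \<in> fst c \<Longrightarrow>
    (vf_rep M c X has_derivative frechet_derivative (vf_rep M c X) (at (snd c p))) (at (snd c p))"
  by (rule Ck_on_has_derivative[OF Ck_on_vf_rep]) auto

lemma vector_fields_outside: "X \<in> VF \<Longrightarrow> p \<notin> points M \<Longrightarrow> X p = 0"
  by (simp add: vector_fields_def)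

text \<open>Smoothness is thus checked by giving a local formula \<open>f c\<close> for the
  components; agreement on the chart domain transfers it to \<open>vf_rep\<close>.\<close>

lemma vector_fieldI:
  assumes "\<And>p. p \<notin> points M \<Longrightarrow> X p = 0"
    and "\<And>c k. c \<in> Atlas M \<Longrightarrow> Ck_on k (snd c ` fst c) (f c)"
    and "\<And>c p. c \<in> Atlas M \<Longrightarrow> p \<in> fst c \<Longrightarrow> tcoord M c p (X p) = f c (snd c p)"
  shows "X \<in> VF"
  unfolding vector_fields_def smooth_on_def
proof (intro CollectI conjI ballI allI impI)
  fix c k assume c: "c \<in> Atlas M"
  show "Ck_on k (snd c ` fst c) (vf_rep M c X)"
    by (rule Ck_on_cong[OF chart_open[OF smooth c] _ assms(2)[OF c]])
      (auto simp: vf_rep_def chart_inv_left[OF smooth c] assms(3)[OF c])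
qed (rule assms(1))

lemma vf_rep_apply: "c \<in> Atlas M \<Longrightarrow> p \<in> fst c \<Longrightarrow> vf_rep M c X (snd c p) = tcoord M c p (X p)"
  by (simp add: vf_rep_def chart_inv_left[OF smooth])

lemma in_points: "c \<in> Atlas M \<Longrightarrow> p \<in> fst c \<Longrightarrow> p \<in> points M"
  using chart_dom[OF smooth] by blast

lemma VF_add:
  assumes "X \<in> VF" "Y \<in> VF"
  shows "(\<lambda>p. X p + Y p) \<in> VF"
  by (rule vector_fieldI[where f="\<lambda>c x. vf_rep M c X x + vf_rep M c Y x"])
    (use assms in \<open>auto intro!: Ck_on_add Ck_on_vf_rep chart_open[OF smooth]
      simp: vector_fields_outside vf_rep_apply linear_add[OF linear_tcoord[OF smooth]]\<close>)

lemma VF_scaleR: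
  assumes "f \<in> smooth_functions M" "Y \<in> VF"
  shows "(\<lambda>p. f p *\<^sub>R Y p) \<in> VF"
proof (rule vector_fieldI[where f="\<lambda>c x. (f \<circ> chart_inv c) x *\<^sub>R vf_rep M c Y x"])
  fix c k assume c: "c \<in> Atlas M"
  have "Ck_on k (snd c ` fst c) (f \<circ> chart_inv c)"
    using assms c by (simp add: smooth_functions_def smooth_on_def)
  then show "Ck_on k (snd c ` fst c) (\<lambda>x. (f \<circ> chart_inv c) x *\<^sub>R vf_rep M c Y x)"
    by (intro Ck_on_scaleR chart_open[OF smooth] Ck_on_vf_rep assms c)
qed (use assms in \<open>auto simp: vector_fields_outside vf_rep_apply chart_inv_left[OF smooth]
      linear_scale[OF linear_tcoord[OF smooth]]\<close>)

text \<open>This is the matrix of \<open>K\<close> in the chart \<open>c\<close> at the point with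
  coordinates \<open>x\<close>, applied to the components \<open>w\<close>.\<close>

abbreviation rep1 :: "('a, 'e) form1 \<Rightarrow> ('a, 'e) chart \<Rightarrow> 'e \<Rightarrow> 'e \<Rightarrow> 'e" where
  "rep1 K c x w \<equiv> tcoord M c (chart_inv c x) (K (chart_inv c x) (inv (tcoord M c (chart_inv c x)) w))"

lemma linear_rep1:
  assumes "vector_1form M K" "c \<in> Atlas M" "x \<in> snd c ` fst c"
  shows "linear (rep1 K c x)"
proof -
  have p: "chart_inv c x \<in> fst c" by (rule chart_inv_in[OF smooth assms(2,3)])
  have "linear (K (chart_inv c x))"
    using assms(1) in_points[OF assms(2) p] by (simp add: vector_1form_def)
  from linear_compose[OF linear_compose[OF linear_inv_tcoord[OF assms(2) p] this]
      linear_tcoord[OF smooth assms(2) p]]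
  show ?thesis by (simp add: comp_def)
qed

lemma Ck_on_rep1:
  "vector_1form M K \<Longrightarrow> c \<in> Atlas M \<Longrightarrow> Ck_on k (snd c ` fst c) (\<lambda>x. rep1 K c x w)"
  by (simp add: vector_1form_def smooth_on_def Let_def)

lemma VF_app1:
  assumes "vector_1form M K" "X \<in> VF"
  shows "app1 M K X \<in> VF"
proof (rule vector_fieldI[where f="\<lambda>c x. rep1 K c x (vf_rep M c X x)"])
  show "Ck_on k (snd c ` fst c) (\<lambda>x. rep1 K c x (vf_rep M c X x))" if c: "c \<in> Atlas M" for c k
    by (rule Ck_on_linear_apply[OF chart_open[OF smooth c] linear_rep1[OF assms(1) c]
          Ck_on_rep1[OF assms(1) c] Ck_on_vf_rep[OF assms(2) c]])
qed (auto simp: app1_def vf_rep_apply chart_inv_left[OF smooth] inv_tcoord_left in_points)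

text \<open>\<open>Ck_on_linear_apply\<close> is used once per slot: first with a fixed vector on
  the left, then with \<open>Y\<close> already inserted on the right.\<close>

lemma VF_app2:
  assumes B: "vector_2form M B" and X: "X \<in> VF" and Y: "Y \<in> VF"
  shows "app2 M B X Y \<in> VF"
proof -
  let ?r = "\<lambda>c x w w'. let p = chart_inv c x in
    tcoord M c p (B p (inv (tcoord M c p) w) (inv (tcoord M c p) w'))"
  have lin: "linear (\<lambda>w. ?r c x w w')" "linear (?r c x w)"
    if c: "c \<in> Atlas M" and x: "x \<in> snd c ` fst c" for c x w w'
  proof -
    have p: "chart_inv c x \<in> fst c" by (rule chart_inv_in[OF smooth c x])
    have "bilinear (B (chart_inv c x))"
      using B in_points[OF c p] by (simp add: vector_2form_def)
    then have l: "linear (B (chart_inv c x) u)" "linear (\<lambda>v. B (chart_inv c x) v u)" for u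
      by (auto simp: bilinear_def)
    show "linear (\<lambda>w. ?r c x w w')" "linear (?r c x w)"
      using linear_compose[OF linear_compose[OF linear_inv_tcoord[OF c p] l(1)] linear_tcoord[OF smooth c p]]
        linear_compose[OF linear_compose[OF linear_inv_tcoord[OF c p] l(2)] linear_tcoord[OF smooth c p]]
      by (simp_all add: comp_def Let_def)
  qed
  show ?thesis
  proof (rule vector_fieldI[where f="\<lambda>c x. ?r c x (vf_rep M c X x) (vf_rep M c Y x)"])
    fix c k assume c: "c \<in> Atlas M"
    note U = chart_open[OF smooth c]
    have k: "Ck_on k (snd c ` fst c) (\<lambda>x. ?r c x w w')" for w w'
      using B c by (simp add: vector_2form_def smooth_on_def)
    have "Ck_on k (snd c ` fst c) (\<lambda>x. ?r c x w (vf_rep M c Y x))" for w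
      by (rule Ck_on_linear_apply[where A="\<lambda>x. ?r c x w", OF U lin(2)[OF c] k Ck_on_vf_rep[OF Y c]])
    then show "Ck_on k (snd c ` fst c) (\<lambda>x. ?r c x (vf_rep M c X x) (vf_rep M c Y x))"
      by (intro Ck_on_linear_apply[where A="\<lambda>x w. ?r c x w (vf_rep M c Y x)",
            OF U lin(1)[OF c] _ Ck_on_vf_rep[OF X c]])
  qed (auto simp: app2_def vf_rep_apply chart_inv_left[OF smooth] inv_tcoord_left in_points Let_def)
qed

text \<open>Passing from the preferred chart to \<open>c\<close> adds to each derivative a second
  derivative of the transition map, and the two terms cancel by symmetry. Smoothness of the bracket
  rests on this, since \<open>chart_at\<close> is chosen point by point.\<close>

lemma tcoord_lie_bracket:
  assumes X: "X \<in> VF" and Y: "Y \<in> VF" and c: "c \<in> Atlas M" "p \<in> fst c"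
  shows "tcoord M c p (lie_bracket M X Y p) =
    frechet_derivative (vf_rep M c Y) (at (snd c p)) (tcoord M c p (X p)) -
    frechet_derivative (vf_rep M c X) (at (snd c p)) (tcoord M c p (Y p))"
proof -
  define d where "d = chart_at M p"
  have p: "p \<in> points M" using in_points[OF c] .
  have d: "d \<in> Atlas M" "p \<in> fst d" using chart_at[OF smooth p] by (simp_all add: d_def)
  let ?U = "snd d ` (fst d \<inter> fst c)" and ?t = "transition d c"
  define y where "y = snd d p"
  have U: "open ?U" "y \<in> ?U" using overlap_open[OF c(1) d(1)] c d by (auto simp: y_def)
  have t2: "Ck_on k ?U ?t" for k by (rule Ck_on_transition[OF c(1) d(1)])
  \<comment> \<open>\<open>?S v w\<close> is the second derivative of the transition map at
    \<open>y\<close> in the directions \<open>v\<close> and \<open>w\<close>.\<close>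
  let ?S = "\<lambda>v. frechet_derivative (\<lambda>z. frechet_derivative ?t (at z) v) (at y)"
  have tc: "tcoord M c p = frechet_derivative ?t (at y)" by (simp add: tcoord_def d_def y_def)
  \<comment> \<open>Two ways to differentiate \<open>vf_rep M c Z \<circ> ?t\<close>: the chain
    rule, and the product rule after the transformation law of components.\<close>
  have Z: "frechet_derivative (vf_rep M c Z) (at (snd c p)) (tcoord M c p w) =
      ?S (Z p) w + tcoord M c p (frechet_derivative (vf_rep M d Z) (at y) w)" if Z: "Z \<in> VF" for Z w
  proof -
    have zp: "vf_rep M d Z y = Z p"
      by (simp add: y_def vf_rep_apply[OF d]) (simp add: d_def tcoord_chart_at[OF smooth p])
    have "((\<lambda>z. frechet_derivative ?t (at z) (vf_rep M d Z z)) has_derivative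
        (\<lambda>w. ?S (vf_rep M d Z y) w + frechet_derivative ?t (at y) (frechet_derivative (vf_rep M d Z) (at y) w))) (at y)"
    proof (rule has_derivative_linear_apply[where A="\<lambda>z. frechet_derivative ?t (at z)", OF U])
      show "linear (frechet_derivative ?t (at z))" if "z \<in> ?U" for z
        using Ck_on_has_derivative[OF t2 that] by (rule has_derivative_linear)
      show "((\<lambda>z. frechet_derivative ?t (at z) v) has_derivative ?S v) (at y)" for v
        using t2[of "Suc (Suc 0)"] U(2) by (intro Ck_on_has_derivative[where k=0 and U="?U"]) auto
      show "(vf_rep M d Z has_derivative frechet_derivative (vf_rep M d Z) (at y)) (at y)"
        unfolding y_def by (rule vf_rep_has_derivative[OF Z d])
    qed
    then have 1: "(vf_rep M c Z \<circ> ?t has_derivative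
        (\<lambda>w. ?S (vf_rep M d Z y) w + frechet_derivative ?t (at y) (frechet_derivative (vf_rep M d Z) (at y) w))) (at y)"
    proof (rule has_derivative_transform_within_open[OF _ U])
      fix z assume "z \<in> ?U"
      then obtain q where q: "q \<in> fst d" "q \<in> fst c" "z = snd d q" by auto
      show "frechet_derivative ?t (at z) (vf_rep M d Z z) = (vf_rep M c Z \<circ> ?t) z"
        using q c d by (simp add: transition_apply vf_rep_apply tcoord_cocycle[of c d q])
    qed
    have "(vf_rep M c Z \<circ> ?t has_derivative
        (frechet_derivative (vf_rep M c Z) (at (snd c p)) \<circ> frechet_derivative ?t (at y))) (at y)"
    proof (rule diff_chain_at)
      show "(?t has_derivative frechet_derivative ?t (at y)) (at y)"
        by (rule Ck_on_has_derivative[OF t2 U(2)])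
      show "(vf_rep M c Z has_derivative frechet_derivative (vf_rep M c Z) (at (snd c p))) (at (?t y))"
        unfolding y_def transition_apply[OF d] by (rule vf_rep_has_derivative[OF Z c])
    qed
    from fun_cong[OF has_derivative_unique[OF this 1]] show ?thesis by (simp add: tc zp)
  qed
  have "lie_bracket M X Y p = frechet_derivative (vf_rep M d Y) (at y) (X p)
      - frechet_derivative (vf_rep M d X) (at y) (Y p)"
    using p by (simp add: lie_bracket_def Let_def d_def y_def)
  moreover have "?S (X p) (Y p) = ?S (Y p) (X p)"
    by (rule symmetric_second_derivative[OF U t2])
  ultimately show ?thesis
    by (simp add: Z X Y linear_diff[OF linear_tcoord[OF smooth c]])
qed

lemma VF_lie_bracket:
  assumes X: "X \<in> VF" and Y: "Y \<in> VF"
  shows "lie_bracket M X Y \<in> VF"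
proof (rule vector_fieldI)
  show "lie_bracket M X Y p = 0" if "p \<notin> points M" for p using that by (simp add: lie_bracket_def)
  show "tcoord M c p (lie_bracket M X Y p) =
      (\<lambda>c x. frechet_derivative (vf_rep M c Y) (at x) (vf_rep M c X x) -
        frechet_derivative (vf_rep M c X) (at x) (vf_rep M c Y x)) c (snd c p)"
    if "c \<in> Atlas M" "p \<in> fst c" for c p
    using that by (simp add: tcoord_lie_bracket[OF X Y] vf_rep_apply)
  have "Ck_on k (snd c ` fst c) (\<lambda>x. frechet_derivative (vf_rep M c Z) (at x) (vf_rep M c W x))"
    if c: "c \<in> Atlas M" and Z: "Z \<in> VF" and W: "W \<in> VF" for c k Z W
  proof (rule Ck_on_linear_apply[OF chart_open[OF smooth c] _ _ Ck_on_vf_rep[OF W c]])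
    show "linear (frechet_derivative (vf_rep M c Z) (at x))" if "x \<in> snd c ` fst c" for x
      using Ck_on_has_derivative[OF Ck_on_vf_rep[OF Z c] that] by (rule has_derivative_linear)
    show "Ck_on k (snd c ` fst c) (\<lambda>x. frechet_derivative (vf_rep M c Z) (at x) v)" for v
      using Ck_on_vf_rep[OF Z c, of "Suc k"] by simp
  qed
  then show "Ck_on k (snd c ` fst c) (\<lambda>x. frechet_derivative (vf_rep M c Y) (at x) (vf_rep M c X x) -
      frechet_derivative (vf_rep M c X) (at x) (vf_rep M c Y x))" if "c \<in> Atlas M" for c k
    using that X Y by (intro Ck_on_diff chart_open[OF smooth])
qed

lemma lie_bracket_skew: "lie_bracket M X Y p = - lie_bracket M Y X p"
  by (simp add: lie_bracket_def Let_def)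

lemma lie_bracket_add_right:
  assumes X: "X \<in> VF" and Y: "Y \<in> VF" and Z: "Z \<in> VF"
  shows "lie_bracket M X (\<lambda>p. Y p + Z p) p = lie_bracket M X Y p + lie_bracket M X Z p"
proof (cases "p \<in> points M")
  case p: True
  let ?c = "chart_at M p"
  note c = chart_at[OF smooth p]
  have "(vf_rep M ?c (\<lambda>p. Y p + Z p) has_derivative
     (\<lambda>v. frechet_derivative (vf_rep M ?c Y) (at (snd ?c p)) v
       + frechet_derivative (vf_rep M ?c Z) (at (snd ?c p)) v)) (at (snd ?c p))"
    by (rule has_derivative_transform_within_open[OF has_derivative_add[OF
          vf_rep_has_derivative[OF Y c] vf_rep_has_derivative[OF Z c]] chart_open[OF smooth c(1)]])
      (use c in \<open>auto simp: vf_rep_apply linear_add[OF linear_tcoord[OF smooth]]\<close>)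
  from frechet_derivative_at[OF this]
  have "frechet_derivative (vf_rep M ?c (\<lambda>p. Y p + Z p)) (at (snd ?c p)) v =
      frechet_derivative (vf_rep M ?c Y) (at (snd ?c p)) v + frechet_derivative (vf_rep M ?c Z) (at (snd ?c p)) v" for v
    by metis
  moreover have "linear (frechet_derivative (vf_rep M ?c X) (at (snd ?c p)))"
    using vf_rep_has_derivative[OF X c] by (rule has_derivative_linear)
  ultimately show ?thesis using p by (simp add: lie_bracket_def Let_def linear_add)
qed (simp add: lie_bracket_def)

lemma lie_bracket_scaleR_right:
  assumes X: "X \<in> VF" and Y: "Y \<in> VF" and f: "f \<in> smooth_functions M" and p: "p \<in> points M"
  shows "lie_bracket M X (\<lambda>p. f p *\<^sub>R Y p) p = f p *\<^sub>R lie_bracket M X Y p + vf_fun M X f p *\<^sub>R Y p"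
proof -
  let ?c = "chart_at M p"
  note c = chart_at[OF smooth p]
  have "Ck_on (Suc 0) (snd ?c ` fst ?c) (f \<circ> chart_inv ?c)"
    using f c unfolding smooth_functions_def smooth_on_def by blast
  then have fd: "(f \<circ> chart_inv ?c has_derivative frechet_derivative (f \<circ> chart_inv ?c) (at (snd ?c p))) (at (snd ?c p))"
    by (rule Ck_on_has_derivative) (use c in auto)
  have v: "vf_rep M ?c Y (snd ?c p) = Y p"
    using vf_rep_apply[OF c] tcoord_chart_at[OF smooth p] by simp
  have "(vf_rep M ?c (\<lambda>p. f p *\<^sub>R Y p) has_derivative
     (\<lambda>v. (f \<circ> chart_inv ?c) (snd ?c p) *\<^sub>R frechet_derivative (vf_rep M ?c Y) (at (snd ?c p)) v
       + frechet_derivative (f \<circ> chart_inv ?c) (at (snd ?c p)) v *\<^sub>R vf_rep M ?c Y (snd ?c p))) (at (snd ?c p))"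
    by (rule has_derivative_transform_within_open[OF has_derivative_scaleR[OF
          fd vf_rep_has_derivative[OF Y c]] chart_open[OF smooth c(1)]])
      (use c in \<open>auto simp: vf_rep_apply chart_inv_left[OF smooth] linear_scale[OF linear_tcoord[OF smooth]]\<close>)
  from frechet_derivative_at[OF this]
  have "frechet_derivative (vf_rep M ?c (\<lambda>p. f p *\<^sub>R Y p)) (at (snd ?c p)) v =
      f p *\<^sub>R frechet_derivative (vf_rep M ?c Y) (at (snd ?c p)) v
      + frechet_derivative (f \<circ> chart_inv ?c) (at (snd ?c p)) v *\<^sub>R Y p" for v
    by (metis (no_types, lifting) v chart_inv_left[OF smooth c] comp_apply)
  moreover have "linear (frechet_derivative (vf_rep M ?c X) (at (snd ?c p)))"
    using vf_rep_has_derivative[OF X c] by (rule has_derivative_linear)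
  ultimately show ?thesis
    using p by (simp add: lie_bracket_def Let_def linear_scale vf_fun_def algebra_simps)
qed

lemma VF_zero: "(\<lambda>_. 0) \<in> VF"
  by (rule vector_fieldI[where f="\<lambda>_ _. 0"])
    (auto intro!: Ck_on_const chart_open[OF smooth] linear_0 linear_tcoord[OF smooth])

lemma lie_bracket_zero_right: "X \<in> VF \<Longrightarrow> lie_bracket M X (\<lambda>_. 0) p = 0"
  using lie_bracket_add_right[OF _ VF_zero VF_zero, of X p] by simp

lemma lie_bracket_zero_left: "X \<in> VF \<Longrightarrow> lie_bracket M (\<lambda>_. 0) X p = 0"
  using lie_bracket_zero_right lie_bracket_skew[of "\<lambda>_. 0" X p] by simp

lemma lie_bracket_add_left:
  "X \<in> VF \<Longrightarrow> Y \<in> VF \<Longrightarrow> Z \<in> VF \<Longrightarrow>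
    lie_bracket M (\<lambda>p. Y p + Z p) X p = lie_bracket M Y X p + lie_bracket M Z X p"
  using lie_bracket_add_right[of X Y Z p] lie_bracket_skew[of "\<lambda>p. Y p + Z p" X p]
    lie_bracket_skew[of Y X p] lie_bracket_skew[of Z X p] by simp

lemma lie_bracket_scaleR_left:
  "X \<in> VF \<Longrightarrow> Y \<in> VF \<Longrightarrow> f \<in> smooth_functions M \<Longrightarrow> p \<in> points M \<Longrightarrow>
    lie_bracket M (\<lambda>p. f p *\<^sub>R Y p) X p = f p *\<^sub>R lie_bracket M Y X p - vf_fun M X f p *\<^sub>R Y p"
  using lie_bracket_scaleR_right[of X Y f p] lie_bracket_skew[of "\<lambda>p. f p *\<^sub>R Y p" X p]
    lie_bracket_skew[of Y X p] by simp

lemma vf_fun_add: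
  assumes "f \<in> smooth_functions M" "p \<in> points M"
  shows "vf_fun M X f p + vf_fun M Y f p = vf_fun M (\<lambda>p. X p + Y p) f p"
proof -
  let ?c = "chart_at M p"
  note c = chart_at[OF smooth assms(2)]
  have "Ck_on (Suc 0) (snd ?c ` fst ?c) (f \<circ> chart_inv ?c)"
    using assms c unfolding smooth_functions_def smooth_on_def by blast
  then have "(f \<circ> chart_inv ?c has_derivative frechet_derivative (f \<circ> chart_inv ?c) (at (snd ?c p))) (at (snd ?c p))"
    by (rule Ck_on_has_derivative) (use c in auto)
  then have "linear (frechet_derivative (f \<circ> chart_inv ?c) (at (snd ?c p)))"
    by (rule has_derivative_linear)
  then show ?thesis by (simp add: vf_fun_def linear_add)
qed

end

section \<open>The algebra of an L-connection\<close>

locale L_connection_mfd = smooth_mfd M for M :: "('a, 'e::euclidean_space) manifold" +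
  fixes n :: nat and L \<Gamma> :: "('a, 'e) form1"
  assumes L: "vertical_endomorphism M n L"
    and \<Gamma>: "L_connection M L \<Gamma>"
begin

abbreviation h :: "('a, 'e) form1" where "h \<equiv> horizontal_projector \<Gamma>"

definition v :: "('a, 'e) form1" where "v p w = (1/2) *\<^sub>R (w - \<Gamma> p w)"

text \<open>The description is meaningful at points of the manifold, where the equality of image and
  kernel of \<open>L p\<close> yields a unique \<open>u\<close>.\<close>

definition R :: "('a, 'e) form1" where "R p w = (THE u. L p u = v p w \<and> v p u = 0)"

lemma form_L: "vector_1form M L" and form_\<Gamma>: "vector_1form M \<Gamma>"
  using L \<Gamma> by (simp_all add: vertical_endomorphism_def L_connection_def)

section \<open>Pointwise identities between \<open>L\<close>, \<open>h\<close>, \<open>v\<close> and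
  \<open>R\<close>\<close>

context
  fixes p assumes p: "p \<in> points M"
begin

lemma linear_L: "linear (L p)" and linear_\<Gamma>: "linear (\<Gamma> p)"
  using form_L form_\<Gamma> p by (simp_all add: vector_1form_def)

lemma linear_h: "linear (h p)"
  by (rule linearI) (simp_all add: horizontal_projector_def linear_add[OF linear_\<Gamma>]
      linear_scale[OF linear_\<Gamma>] algebra_simps)

lemma linear_v: "linear (v p)"
  by (rule linearI) (simp_all add: v_def linear_add[OF linear_\<Gamma>]
      linear_scale[OF linear_\<Gamma>] algebra_simps)

lemma hv_sum: "h p w + v p w = w"
  by (simp add: horizontal_projector_def v_def algebra_simps flip: scaleR_add_left)

lemma range_L: "range (L p) = {u. L p u = 0}"
  using L p by (simp add: vertical_endomorphism_def)

lemma L_\<Gamma>: "L p (\<Gamma> p w) = L p w" and \<Gamma>_L: "\<Gamma> p (L p w) = - L p w"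
  using \<Gamma> p by (simp_all add: L_connection_def)

lemma L_L: "L p (L p w) = 0" using range_L by blast

lemma L_v: "L p (v p w) = 0"
  by (simp add: v_def linear_scale[OF linear_L] linear_diff[OF linear_L] L_\<Gamma>)

lemma v_L: "v p (L p w) = L p w"
  by (simp add: v_def \<Gamma>_L flip: scaleR_2)

lemma vertical_v: "L p u = 0 \<Longrightarrow> v p u = u"
proof -
  assume "L p u = 0"
  then have "u \<in> range (L p)" by (simp add: range_L)
  then show "v p u = u" by (auto simp: v_L)
qed

lemma v_v: "v p (v p w) = v p w" by (simp add: vertical_v L_v)

lemma h_eq: "h p w = w - v p w" using hv_sum[of w] by (simp add: algebra_simps)

lemma h_L: "h p (L p w) = 0" by (simp add: h_eq v_L)

lemma L_h: "L p (h p w) = L p w" by (simp add: h_eq linear_diff[OF linear_L] L_v)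

lemma v_h: "v p (h p w) = 0" by (simp add: h_eq linear_diff[OF linear_v] v_v)

lemma h_v: "h p (v p w) = 0" by (simp add: h_eq v_v)

lemma h_h: "h p (h p w) = h p w" using hv_sum[of "h p w"] by (simp add: v_h)

text \<open>The difference lies in the kernel of \<open>L p\<close>, hence is vertical, and
  \<open>v p\<close> is the identity on vertical vectors.\<close>

lemma L_v_unique: "L p u = L p u' \<Longrightarrow> v p u = v p u' \<Longrightarrow> u = u'"
  using vertical_v[of "u - u'"] by (simp add: linear_diff[OF linear_L] linear_diff[OF linear_v])

lemma L_R: "L p (R p w) = v p w" and v_R: "v p (R p w) = 0"
proof -
  have "v p w \<in> range (L p)" unfolding range_L by (simp add: L_v)
  \<comment> \<open>Any preimage under \<open>L p\<close> will do: its horizontal part keeps the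
    image and loses the vertical component.\<close>
  then obtain t where "v p w = L p t" by blast
  then have t: "L p (h p t) = v p w" "v p (h p t) = 0" by (simp_all add: L_h v_h)
  have "L p (R p w) = v p w \<and> v p (R p w) = 0"
    unfolding R_def
  proof (rule theI[where a="h p t"])
    show "u = h p t" if "L p u = v p w \<and> v p u = 0" for u
      by (rule L_v_unique) (simp_all add: t that)
  qed (simp add: t)
  then show "L p (R p w) = v p w" "v p (R p w) = 0" by auto
qed

lemma R_eqI: "L p u = v p w \<Longrightarrow> v p u = 0 \<Longrightarrow> R p w = u"
  by (rule L_v_unique) (simp_all add: L_R v_R)

lemma linear_R: "linear (R p)"
  by (rule linearI; rule R_eqI) (simp_all add: linear_add[OF linear_L] linear_add[OF linear_v]
      linear_scale[OF linear_L] linear_scale[OF linear_v] L_R v_R)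

lemma h_R: "h p (R p w) = R p w" by (simp add: h_eq v_R)
lemma R_L: "R p (L p w) = h p w" by (rule R_eqI) (simp_all add: v_L L_h v_h)
lemma R_v: "R p (v p w) = R p w" by (rule R_eqI) (simp_all add: L_R v_R v_v)
lemma R_h: "R p (h p w) = 0"
  by (rule R_eqI) (simp_all add: linear_0[OF linear_L] linear_0[OF linear_v] v_h)
lemma \<Gamma>_eq: "\<Gamma> p w + w = h p w + h p w"
  by (simp add: horizontal_projector_def algebra_simps flip: scaleR_2)

text \<open>A multiplication table that reduces the composites of \<open>L\<close>,
  \<open>h\<close>, \<open>v\<close> and \<open>R\<close> occurring below.\<close>

lemmas point_simps = linear_add[OF linear_L] linear_add[OF linear_h] linear_add[OF linear_v] linear_add[OF linear_R]
  linear_diff[OF linear_L] linear_diff[OF linear_h] linear_diff[OF linear_v] linear_diff[OF linear_R]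
  linear_neg[OF linear_L] linear_neg[OF linear_h] linear_neg[OF linear_v] linear_neg[OF linear_R]
  linear_scale[OF linear_L] linear_scale[OF linear_h] linear_scale[OF linear_v] linear_scale[OF linear_R]
  linear_0[OF linear_L] linear_0[OF linear_h] linear_0[OF linear_v] linear_0[OF linear_R]
  L_L L_v L_h L_R v_L v_v v_h v_R h_L h_v h_h h_R R_L R_v R_h

end

section \<open>Action of these forms on vector fields\<close>

lemma form_v: "vector_1form M v"
  unfolding vector_1form_def smooth_on_def
proof (intro conjI ballI allI linear_v)
  fix c w k assume c: "c \<in> Atlas M"
  have "Ck_on k (snd c ` fst c) (\<lambda>x. (1/2) *\<^sub>R (w - rep1 \<Gamma> c x w))"
    by (intro Ck_on_scaleR Ck_on_diff Ck_on_const chart_open[OF smooth c] Ck_on_rep1[OF form_\<Gamma> c])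
  then show "Ck_on k (snd c ` fst c) (\<lambda>x. let p = chart_inv c x in tcoord M c p (v p (inv (tcoord M c p) w)))"
  proof (rule Ck_on_cong[OF chart_open[OF smooth c], rotated])
    fix x assume "x \<in> snd c ` fst c"
    then have q: "chart_inv c x \<in> fst c" by (rule chart_inv_in[OF smooth c])
    show "(1/2) *\<^sub>R (w - rep1 \<Gamma> c x w) = (let p = chart_inv c x in tcoord M c p (v p (inv (tcoord M c p) w)))"
      by (simp add: Let_def v_def linear_scale[OF linear_tcoord[OF smooth c q]]
          linear_diff[OF linear_tcoord[OF smooth c q]] inv_tcoord_right[OF c q])
  qed
qed

lemma app1_point: "p \<in> points M \<Longrightarrow> app1 M K X p = K p (X p)"
  and app1_outside: "p \<notin> points M \<Longrightarrow> app1 M K X p = 0"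
  by (simp_all add: app1_def)

lemma VF_L: "X \<in> VF \<Longrightarrow> app1 M L X \<in> VF" and VF_v: "X \<in> VF \<Longrightarrow> app1 M v X \<in> VF"
  and VF_\<Gamma>: "X \<in> VF \<Longrightarrow> app1 M \<Gamma> X \<in> VF"
  by (simp_all add: VF_app1 form_L form_v form_\<Gamma>)

lemma app1_h_eq: "X \<in> VF \<Longrightarrow> app1 M h X = (\<lambda>p. X p - app1 M v X p)"
  by (auto simp: fun_eq_iff app1_def h_eq vector_fields_outside)

lemma VF_h: "X \<in> VF \<Longrightarrow> app1 M h X \<in> VF"
  by (simp add: app1_h_eq vector_fields_diff[OF smooth] VF_v)

text \<open>\<open>R X\<close> solves the injective linear system \<open>(L u, v u) = (v X, 0)\<close>.\<close>

lemma VF_R: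
  assumes X: "X \<in> VF"
  shows "app1 M R X \<in> VF"
proof (rule vector_fieldI[where f="\<lambda>c. vf_rep M c (app1 M R X)"])
  fix c k assume c: "c \<in> Atlas M"
  note U = chart_open[OF smooth c]
  let ?A = "\<lambda>x w. (rep1 L c x w, rep1 v c x w)"
  show "Ck_on k (snd c ` fst c) (vf_rep M c (app1 M R X))"
  proof (rule Ck_on_linear_solution[where A="?A" and w="\<lambda>x. (vf_rep M c (app1 M v X) x, 0::'e)", OF U])
    show "Ck_on k (snd c ` fst c) (\<lambda>x. ?A x w)" for w
      by (intro Ck_on_Pair U Ck_on_rep1 form_L form_v c)
    show "Ck_on k (snd c ` fst c) (\<lambda>x. (vf_rep M c (app1 M v X) x, 0::'e))"
      by (intro Ck_on_Pair U Ck_on_vf_rep VF_v Ck_on_const X c)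
    fix x assume x: "x \<in> snd c ` fst c"
    define p where "p = chart_inv c x"
    have q: "p \<in> fst c" unfolding p_def by (rule chart_inv_in[OF smooth c x])
    have p: "p \<in> points M" by (rule in_points[OF c q])
    note lt = linear_tcoord[OF smooth c q]
    have lA: "linear (rep1 L c x)" "linear (rep1 v c x)"
      using linear_rep1 form_L form_v c x by blast+
    show "linear (?A x)"
      by (rule linearI) (simp_all add: linear_add[OF lA(1)] linear_add[OF lA(2)]
          linear_scale[OF lA(1)] linear_scale[OF lA(2)])
    show "inj (?A x)"
    proof (rule injI)
      fix w w' assume "?A x w = ?A x w'"
      then have "L p (inv (tcoord M c p) w) = L p (inv (tcoord M c p) w')"
        "v p (inv (tcoord M c p) w) = v p (inv (tcoord M c p) w')"
        using bij_is_inj[OF bij_tcoord[OF c q]] by (simp_all add: inj_eq flip: p_def)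
      from L_v_unique[OF p this] show "w = w'"
        by (metis inv_tcoord_right[OF c q])
    qed
    show "?A x (vf_rep M c (app1 M R X) x) = (vf_rep M c (app1 M v X) x, 0)"
      using p by (simp add: vf_rep_def inv_tcoord_left[OF c q] app1_point L_R v_R linear_0[OF lt] flip: p_def)
  qed
qed (auto simp: app1_outside vf_rep_apply)

lemmas VF_intros = VF_L VF_v VF_\<Gamma> VF_h VF_R VF_add VF_scaleR VF_lie_bracket VF_zero

lemma app1_h_v_sum: "X \<in> VF \<Longrightarrow> (\<lambda>p. app1 M h X p + app1 M v X p) = X"
  by (auto simp: fun_eq_iff app1_def hv_sum vector_fields_outside)

text \<open>The same table for fields, needed because a Lie bracket sees its arguments as fields and
  not as vectors at one point.\<close>

lemma app1_compose:
  "app1 M L (app1 M L X) = (\<lambda>_. 0)" "app1 M L (app1 M v X) = (\<lambda>_. 0)"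
  "app1 M L (app1 M h X) = app1 M L X" "app1 M L (app1 M R X) = app1 M v X"
  "app1 M v (app1 M L X) = app1 M L X" "app1 M v (app1 M v X) = app1 M v X"
  "app1 M v (app1 M h X) = (\<lambda>_. 0)" "app1 M v (app1 M R X) = (\<lambda>_. 0)"
  "app1 M h (app1 M L X) = (\<lambda>_. 0)" "app1 M h (app1 M v X) = (\<lambda>_. 0)"
  "app1 M h (app1 M h X) = app1 M h X" "app1 M h (app1 M R X) = app1 M R X"
  "app1 M R (app1 M L X) = app1 M h X" "app1 M R (app1 M v X) = app1 M R X"
  "app1 M R (app1 M h X) = (\<lambda>_. 0)"
  by (auto simp: fun_eq_iff app1_def point_simps)

lemma app1_add:
  "app1 M L (\<lambda>p. X p + Y p) = (\<lambda>p. app1 M L X p + app1 M L Y p)"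
  "app1 M h (\<lambda>p. X p + Y p) = (\<lambda>p. app1 M h X p + app1 M h Y p)"
  "app1 M v (\<lambda>p. X p + Y p) = (\<lambda>p. app1 M v X p + app1 M v Y p)"
  "app1 M R (\<lambda>p. X p + Y p) = (\<lambda>p. app1 M R X p + app1 M R Y p)"
  by (auto simp: fun_eq_iff app1_def point_simps)

lemma app1_scaleR:
  "app1 M L (\<lambda>p. f p *\<^sub>R X p) = (\<lambda>p. f p *\<^sub>R app1 M L X p)"
  "app1 M h (\<lambda>p. f p *\<^sub>R X p) = (\<lambda>p. f p *\<^sub>R app1 M h X p)"
  "app1 M v (\<lambda>p. f p *\<^sub>R X p) = (\<lambda>p. f p *\<^sub>R app1 M v X p)"
  "app1 M R (\<lambda>p. f p *\<^sub>R X p) = (\<lambda>p. f p *\<^sub>R app1 M R X p)"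
  by (auto simp: fun_eq_iff app1_def point_simps)

text \<open>In \<open>[L, L] = 0\<close> the two terms with \<open>L\<close> applied twice vanish
  and the others come in equal pairs, whence the factor 2 to be cancelled.\<close>

lemma lie_bracket_L_L:
  assumes "X \<in> VF" "Y \<in> VF" "p \<in> points M"
  shows "lie_bracket M (app1 M L X) (app1 M L Y) p =
    L p (lie_bracket M (app1 M L X) Y p) + L p (lie_bracket M X (app1 M L Y) p)"
proof -
  let ?a = "lie_bracket M (app1 M L X) (app1 M L Y) p"
  let ?b = "L p (lie_bracket M (app1 M L X) Y p) + L p (lie_bracket M X (app1 M L Y) p)"
  have "fn_bracket11 M L L X Y p = 0"
    using L assms unfolding vertical_endomorphism_def by (metis (no_types))
  then have "2 *\<^sub>R ?a = 2 *\<^sub>R ?b"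
    using assms(3) by (simp add: fn_bracket11_def app1_point L_L algebra_simps scaleR_2)
  then show ?thesis by simp
qed

text \<open>Involutivity of the vertical bundle: \<open>v\<close> is \<open>L\<close> after
  \<open>R\<close>, so \<open>[L, L] = 0\<close> puts the bracket in the image of \<open>L\<close>,
  which \<open>L\<close> kills.\<close>

lemma L_lie_bracket_v_v:
  assumes "X \<in> VF" "Y \<in> VF" "p \<in> points M"
  shows "L p (lie_bracket M (app1 M v X) (app1 M v Y) p) = 0"
  using lie_bracket_L_L[OF VF_R[OF assms(1)] VF_R[OF assms(2)] assms(3)] assms(3)
  by (simp add: app1_compose point_simps)

end


section \<open>The reducible L-lift\<close>

locale semibasic_torsion_mfd = L_connection_mfd M n L \<Gamma>
  for M :: "('a, 'e::euclidean_space) manifold" and n :: nat and L \<Gamma> :: "('a, 'e) form1" +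
  fixes C :: "'a \<Rightarrow> 'e" and B :: "('a, 'e) form2"
  assumes C: "canonical_field M L C"
    and form_B: "vector_2form M B" and semibasic_B: "semibasic2 M L B"
    and potential_B: "\<And>X p. X \<in> vector_fields M \<Longrightarrow> p \<in> points M \<Longrightarrow>
           app1 M (potential M L C B) X p + fn_bracket01 M C (horizontal_projector \<Gamma>) X p = 0"
begin

lemma VF_C: "C \<in> VF" using C by (simp add: canonical_field_def vertical_fields_def)

lemma app1_C: "app1 M v C = C" "app1 M h C = (\<lambda>_. 0)" "app1 M L C = (\<lambda>_. 0)"
proof -
  have "L p (C p) = 0" if "p \<in> points M" for p
    using C that range_L[OF that] by (auto simp: canonical_field_def vertical_fields_def vertical_space_def)
  then show "app1 M v C = C" "app1 M h C = (\<lambda>_. 0)" "app1 M L C = (\<lambda>_. 0)"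
    by (auto simp: fun_eq_iff app1_def vertical_v h_eq vector_fields_outside[OF VF_C])
qed

lemma lie_bracket_C_L:
  assumes "X \<in> VF" "p \<in> points M"
  shows "lie_bracket M C (app1 M L X) p - L p (lie_bracket M C X p) = - L p (X p)"
proof -
  have "fn_bracket01 M C L X = (\<lambda>p. - app1 M L X p)"
    using C assms(1) by (simp add: canonical_field_def)
  from fun_cong[OF this, of p] show ?thesis
    using assms(2) by (simp add: fn_bracket01_def app1_point)
qed

text \<open>Since \<open>L\<close> sends \<open>RC\<close> to \<open>C\<close>, the bracket
  \<open>[LX, C]\<close> is given both by \<open>[L, L] = 0\<close> and by
  \<open>[C, L] = -L\<close>; on comparison the terms in \<open>[C, X]\<close> cancel. This is the
  source of \<open>D_{LX} C = LX\<close>.\<close>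

lemma L_lie_bracket_L_RC:
  assumes X: "X \<in> VF" and p: "p \<in> points M"
  shows "L p (lie_bracket M (app1 M L X) (app1 M R C) p) = L p (X p)"
  using lie_bracket_L_L[OF X VF_R[OF VF_C] p] lie_bracket_C_L[OF X p] p
    lie_bracket_skew[of "app1 M L X" C p] lie_bracket_skew[of X C p]
  by (simp add: app1_compose app1_C point_simps algebra_simps)

lemma bilinear_B: "p \<in> points M \<Longrightarrow> bilinear (B p)" and skew_B: "p \<in> points M \<Longrightarrow> B p u w = - B p w u"
  using form_B unfolding vector_2form_def by blast+

lemma L_B: "p \<in> points M \<Longrightarrow> L p (B p u w) = 0"
  using semibasic_B by (simp add: semibasic2_def)

lemma v_B: "p \<in> points M \<Longrightarrow> v p (B p u w) = B p u w"
  by (simp add: vertical_v L_B)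

lemma h_B: "p \<in> points M \<Longrightarrow> h p (B p u w) = 0"
  by (simp add: h_eq v_B)

lemma B_L:
  assumes X: "X \<in> VF" and p: "p \<in> points M"
  shows "B p (app1 M L X p) w = 0" "B p w (app1 M L X p) = 0"
proof -
  have "app1 M L X \<in> vertical_fields M L"
    using VF_L[OF X] by (auto simp: vertical_fields_def vertical_space_def app1_point)
  then show "B p (app1 M L X p) w = 0" for w using semibasic_B p unfolding semibasic2_def by blast
  then show "B p w (app1 M L X p) = 0" by (subst skew_B[OF p]) simp
qed

lemma B_v:
  assumes "X \<in> VF" "p \<in> points M"
  shows "B p (app1 M v X p) w = 0" "B p w (app1 M v X p) = 0"
  using B_L[OF VF_R[OF assms(1)] assms(2)] by (simp_all add: app1_compose)

lemma B_h:
  assumes "X \<in> VF" "p \<in> points M"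
  shows "B p (app1 M h X p) w = B p (X p) w" "B p w (app1 M h X p) = B p w (X p)"
  using B_v[OF assms] assms
  by (simp_all add: app1_h_eq bilinear_lsub[OF bilinear_B] bilinear_rsub[OF bilinear_B])

text \<open>The summands are, in order, the derivatives of \<open>hY\<close> along
  \<open>vX\<close>, of \<open>vY\<close> along \<open>vX\<close>, of \<open>vY\<close> along
  \<open>hX\<close> (two terms) and of \<open>hY\<close> along \<open>hX\<close>. The value 0 off
  the manifold is what vector fields require.\<close>

definition lift :: "('a, 'e) connection" where
  "lift X Y p = (if p \<in> points M then
     h p (lie_bracket M (app1 M v X) (app1 M h Y) p)
     + L p (lie_bracket M (app1 M v X) (app1 M R Y) p)
     + v p (lie_bracket M (app1 M h X) (app1 M v Y) p) - B p (app1 M R Y p) (X p)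
     + R p (lie_bracket M (app1 M h X) (app1 M L Y) p - B p (Y p) (X p)) else 0)"

lemma lift_point: "p \<in> points M \<Longrightarrow> lift X Y p =
     h p (lie_bracket M (app1 M v X) (app1 M h Y) p)
     + L p (lie_bracket M (app1 M v X) (app1 M R Y) p)
     + v p (lie_bracket M (app1 M h X) (app1 M v Y) p) - B p (app1 M R Y p) (X p)
     + R p (lie_bracket M (app1 M h X) (app1 M L Y) p - B p (Y p) (X p))"
  and lift_outside: "p \<notin> points M \<Longrightarrow> lift X Y p = 0"
  by (simp_all add: lift_def)

lemma VF_lift:
  assumes X: "X \<in> VF" and Y: "Y \<in> VF"
  shows "lift X Y \<in> VF"
proof -
  have "lift X Y = (\<lambda>p. ((((app1 M h (lie_bracket M (app1 M v X) (app1 M h Y)) p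
     + app1 M L (lie_bracket M (app1 M v X) (app1 M R Y)) p)
     + app1 M v (lie_bracket M (app1 M h X) (app1 M v Y)) p) - app2 M B (app1 M R Y) X p)
     + app1 M R (\<lambda>p. lie_bracket M (app1 M h X) (app1 M L Y) p - app2 M B Y X p) p))"
    by (auto simp: fun_eq_iff lift_def app1_def app2_def)
  then show ?thesis
    by (simp only:) (intro VF_add VF_h VF_L VF_v VF_R VF_lie_bracket vector_fields_diff[OF smooth]
        VF_app2 form_B X Y)
qed

section \<open>Connection axioms and parallelism for the lift\<close>

lemmas bracket_add = lie_bracket_add_left lie_bracket_add_right
lemmas bracket_scaleR = lie_bracket_scaleR_left lie_bracket_scaleR_right
lemmas bracket_zero = lie_bracket_zero_left lie_bracket_zero_right
lemmas B_simps = bilinear_ladd[OF bilinear_B] bilinear_radd[OF bilinear_B] bilinear_lmul[OF bilinear_B]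
  bilinear_rmul[OF bilinear_B] bilinear_lzero[OF bilinear_B] bilinear_rzero[OF bilinear_B]
  L_B v_B h_B B_L B_v B_h

lemma lift_add_left:
  assumes "X \<in> VF" "X' \<in> VF" "Y \<in> VF"
  shows "lift (\<lambda>p. X p + X' p) Y p = lift X Y p + lift X' Y p"
proof (cases "p \<in> points M")
  case True
  with assms show ?thesis
    by (simp add: lift_point app1_add bracket_add VF_intros point_simps B_simps)
qed (simp add: lift_outside)

lemma lift_add_right:
  assumes "X \<in> VF" "Y \<in> VF" "Y' \<in> VF"
  shows "lift X (\<lambda>p. Y p + Y' p) p = lift X Y p + lift X Y' p"
proof (cases "p \<in> points M")
  case True
  with assms show ?thesis
    by (simp add: lift_point app1_add bracket_add VF_intros point_simps B_simps)
qed (simp add: lift_outside)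

text \<open>The brackets contribute derivatives of \<open>f\<close> times \<open>vX\<close> or
  \<open>hX\<close>; these are removed by \<open>hv = 0\<close>, \<open>Lv = 0\<close>,
  \<open>vh = 0\<close> and \<open>Rh = 0\<close> in the four bracket terms.\<close>

lemma lift_scaleR_left:
  assumes "f \<in> smooth_functions M" "X \<in> VF" "Y \<in> VF"
  shows "lift (\<lambda>p. f p *\<^sub>R X p) Y p = f p *\<^sub>R lift X Y p"
proof (cases "p \<in> points M")
  case True
  with assms show ?thesis
    by (simp add: lift_point app1_scaleR bracket_scaleR VF_intros point_simps B_simps app1_point
        scaleR_diff_right scaleR_add_right)
qed (simp add: lift_outside)

text \<open>Here the derivative terms survive, since \<open>LR = v\<close> and
  \<open>RL = h\<close>: each of \<open>hY\<close> and \<open>vY\<close> occurs once with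
  \<open>(vX) f\<close> and once with \<open>(hX) f\<close>, which together make
  \<open>(X f) Y\<close>.\<close>

lemma lift_scaleR_right:
  assumes f: "f \<in> smooth_functions M" and X: "X \<in> VF" and Y: "Y \<in> VF"
  shows "lift X (\<lambda>p. f p *\<^sub>R Y p) p = vf_fun M X f p *\<^sub>R Y p + f p *\<^sub>R lift X Y p"
proof (cases "p \<in> points M")
  case p: True
  let ?v = "vf_fun M (app1 M v X) f p" and ?h = "vf_fun M (app1 M h X) f p"
  have "lift X (\<lambda>p. f p *\<^sub>R Y p) p = f p *\<^sub>R lift X Y p
     + ?v *\<^sub>R h p (Y p) + ?v *\<^sub>R v p (Y p) + ?h *\<^sub>R v p (Y p) + ?h *\<^sub>R h p (Y p)"
    using f X Y p
    by (simp add: lift_point app1_scaleR bracket_scaleR VF_intros point_simps B_simps app1_point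
        scaleR_diff_right scaleR_add_right)
  also have "\<dots> = f p *\<^sub>R lift X Y p + (?h + ?v) *\<^sub>R (h p (Y p) + v p (Y p))"
    by (simp add: scaleR_add_left scaleR_add_right)
  finally show ?thesis by (simp add: vf_fun_add[OF f p] app1_h_v_sum[OF X] hv_sum[OF p])
qed (use X Y in \<open>simp add: lift_outside vector_fields_outside\<close>)

lemma lift_h:
  assumes "X \<in> VF" "Y \<in> VF" shows "lift X (app1 M h Y) = app1 M h (lift X Y)"
proof
  fix p
  show "lift X (app1 M h Y) p = app1 M h (lift X Y) p"
  proof (cases "p \<in> points M")
    case True
    with assms have "lift X (app1 M h Y) p = h p (lift X Y p)"
      by (simp add: lift_point app1_compose bracket_zero VF_intros point_simps B_simps)
    with True show ?thesis by (simp add: app1_point)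
  qed (simp add: lift_outside app1_outside)
qed

text \<open>Two components match: \<open>L[vX, R(LY)]\<close> is \<open>L\<close> of
  \<open>h[vX, hY]\<close> because \<open>RL = h\<close>, and \<open>v[hX, LY] - B(Y, X)\<close> is
  \<open>L\<close> of the \<open>R\<close> term because \<open>LR = v\<close>. The others vanish on
  both sides.\<close>

lemma lift_L:
  assumes "X \<in> VF" "Y \<in> VF" shows "lift X (app1 M L Y) = app1 M L (lift X Y)"
proof
  fix p
  show "lift X (app1 M L Y) p = app1 M L (lift X Y) p"
  proof (cases "p \<in> points M")
    case True
    with assms have "lift X (app1 M L Y) p = L p (lift X Y p)"
      by (simp add: lift_point app1_compose bracket_zero VF_intros point_simps B_simps)
    with True show ?thesis by (simp add: app1_point)
  qed (simp add: lift_outside app1_outside)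
qed

text \<open>\<open>\<Gamma> + I = 2h\<close> in additive form, so that additivity alone passes
  between statements about \<open>h\<close> and about \<open>\<Gamma>\<close>.\<close>

lemma app1_\<Gamma>: "(\<lambda>p. app1 M \<Gamma> X p + X p) = (\<lambda>p. app1 M h X p + app1 M h X p)" if "X \<in> VF"
  using that by (auto simp: fun_eq_iff app1_def \<Gamma>_eq vector_fields_outside)

lemma lift_\<Gamma>:
  assumes X: "X \<in> VF" and Y: "Y \<in> VF" shows "lift X (app1 M \<Gamma> Y) = app1 M \<Gamma> (lift X Y)"
proof
  fix p
  have "lift X (app1 M \<Gamma> Y) p + lift X Y p = lift X (app1 M h Y) p + lift X (app1 M h Y) p"
    unfolding lift_add_right[OF X VF_\<Gamma>[OF Y] Y, symmetric] lift_add_right[OF X VF_h[OF Y] VF_h[OF Y], symmetric]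
    by (simp add: app1_\<Gamma>[OF Y])
  also have "\<dots> = app1 M \<Gamma> (lift X Y) p + lift X Y p"
    using fun_cong[OF app1_\<Gamma>[OF VF_lift[OF X Y]], of p] by (simp add: lift_h X Y)
  finally show "lift X (app1 M \<Gamma> Y) p = app1 M \<Gamma> (lift X Y) p" by simp
qed

text \<open>After \<open>Y\<close> is split into \<open>hY\<close> and \<open>vY\<close> and the
  bracket of \<open>LX\<close> with \<open>vY\<close> is rewritten by \<open>[L, L] = 0\<close>, all
  brackets cancel and only the \<open>B\<close> term of \<open>lift Y (app1 M L X)\<close> is
  left.\<close>

lemma lift_torsion:
  assumes X: "X \<in> VF" and Y: "Y \<in> VF"
  shows "torsion M lift (app1 M L X) Y = app2 M B X Y"
proof
  fix p
  show "torsion M lift (app1 M L X) Y p = app2 M B X Y p"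
  proof (cases "p \<in> points M")
    case p: True
    note F = X Y VF_intros
    have 1: "lift (app1 M L X) Y p = h p (lie_bracket M (app1 M L X) (app1 M h Y) p)
        + L p (lie_bracket M (app1 M L X) (app1 M R Y) p)"
      using p by (simp add: lift_point app1_compose bracket_zero F point_simps B_simps)
    have 2: "lift Y (app1 M L X) p = L p (lie_bracket M (app1 M v Y) (app1 M h X) p)
        + v p (lie_bracket M (app1 M h Y) (app1 M L X) p) - B p (X p) (Y p)"
      using p by (simp add: lift_point app1_compose bracket_zero F point_simps B_simps)
    have 3: "lie_bracket M (app1 M L X) Y p =
        h p (lie_bracket M (app1 M L X) (app1 M h Y) p) - v p (lie_bracket M (app1 M h Y) (app1 M L X) p)
        + lie_bracket M (app1 M L X) (app1 M v Y) p"
      using lie_bracket_add_right[OF VF_L[OF X] VF_h[OF Y] VF_v[OF Y], of p]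
        lie_bracket_skew[of "app1 M L X" "app1 M h Y" p] hv_sum[OF p, of "lie_bracket M (app1 M L X) (app1 M h Y) p"]
      by (simp add: app1_h_v_sum[OF Y] point_simps[OF p])
    have 4: "lie_bracket M (app1 M L X) (app1 M v Y) p =
        L p (lie_bracket M (app1 M L X) (app1 M R Y) p) + L p (lie_bracket M X (app1 M v Y) p)"
      using lie_bracket_L_L[OF X VF_R[OF Y] p] by (simp add: app1_compose)
    \<comment> \<open>Only the horizontal part of \<open>X\<close> counts, because \<open>L\<close>
      kills the bracket of \<open>vX\<close> with \<open>vY\<close>.\<close>
    have 5: "L p (lie_bracket M X (app1 M v Y) p) = - L p (lie_bracket M (app1 M v Y) (app1 M h X) p)"
      using lie_bracket_add_left[OF VF_v[OF Y] VF_h[OF X] VF_v[OF X], of p]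
        L_lie_bracket_v_v[OF X Y p] lie_bracket_skew[of "app1 M h X" "app1 M v Y" p]
      by (simp add: app1_h_v_sum[OF X] point_simps[OF p])
    show ?thesis
      using p by (simp add: torsion_def app2_def 1 2 3 4 5)
  qed (use X Y in \<open>simp add: torsion_def lift_outside app2_def lie_bracket_def\<close>)
qed

text \<open>As \<open>hC = LC = 0\<close> and \<open>B(C, X) = 0\<close>, what remains is
  \<open>L[vX, RC]\<close>, which is \<open>vX\<close>, and \<open>v[hX, C] - B(RC, X)\<close>,
  which vanishes by the hypothesis on the potential. Normality and the induced connection are both
  read off from this.\<close>

lemma lift_C:
  assumes X: "X \<in> VF"
  shows "lift X C = app1 M v X"
proof
  fix p
  show "lift X C p = app1 M v X p"
  proof (cases "p \<in> points M")
    case p: True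
    note F = X VF_C VF_intros
    have "semispray M L C (app1 M R C)"
      by (simp add: semispray_def VF_R VF_C app1_compose app1_C)
    from potential_eq[OF smooth L form_B semibasic_B this p, of "X p"]
    have "B p (app1 M R C p) (X p) + lie_bracket M C (app1 M h X) p - h p (lie_bracket M C X p) = 0"
      using potential_B[OF X p] p by (simp add: fn_bracket01_def app1_point algebra_simps)
    \<comment> \<open>The vertical part drops \<open>h[C, X]\<close> and keeps
      \<open>B\<close>.\<close>
    then have "v p (B p (app1 M R C p) (X p) + lie_bracket M C (app1 M h X) p - h p (lie_bracket M C X p)) = v p 0"
      by simp
    then have "B p (app1 M R C p) (X p) = - v p (lie_bracket M C (app1 M h X) p)"
      using p by (simp add: point_simps B_simps eq_neg_iff_add_eq_0)
    then have "v p (lie_bracket M (app1 M h X) C p) = B p (app1 M R C p) (X p)"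
      using p lie_bracket_skew[of "app1 M h X" C p] by (simp add: point_simps)
    moreover have "L p (lie_bracket M (app1 M v X) (app1 M R C) p) = v p (X p)"
      using L_lie_bracket_L_RC[OF VF_R[OF X] p] p by (simp add: app1_compose app1_point point_simps)
    moreover have "B p (C p) (X p) = 0"
      using B_v(1)[OF VF_C p] by (simp add: app1_C)
    ultimately show ?thesis
      using p by (simp add: lift_point app1_C bracket_zero F point_simps app1_point[of p v])
  qed (simp add: lift_outside app1_outside)
qed

section \<open>Existence: the lift as a linear connection\<close>

definition lift_connection :: "('a, 'e) connection" where
  "lift_connection = (\<lambda>X\<in>VF. \<lambda>Y\<in>VF. lift X Y)"

lemma lift_connection: "X \<in> VF \<Longrightarrow> Y \<in> VF \<Longrightarrow> lift_connection X Y = lift X Y"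
  by (simp add: lift_connection_def)

lemma linear_connection_lift: "linear_connection M lift_connection"
  unfolding linear_connection_def
proof (intro conjI ballI)
  show "lift_connection \<in> VF \<rightarrow>\<^sub>E VF \<rightarrow>\<^sub>E VF"
    by (auto simp: lift_connection_def VF_lift)
qed (auto simp: fun_eq_iff lift_connection VF_intros lift_add_left lift_add_right
      lift_scaleR_left lift_scaleR_right)

text \<open>\<open>lift_C\<close> identifies the form \<open>D_X C\<close> with \<open>v\<close>,
  which is the identity on the vertical bundle.\<close>

lemma regular_lift: "regular_1form M L C lift_connection v"
  unfolding regular_1form_def
proof (intro conjI ballI form_v)
  show "app1 M v X = lift_connection X C" if "X \<in> VF" for X
    by (simp add: lift_connection that VF_C lift_C)
  show "bij_betw (v z) (vertical_space L z) (vertical_space L z)" if z: "z \<in> points M" for z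
    by (rule bij_betwI[where g="\<lambda>u. u"]) (auto simp: vertical_space_def v_L[OF z])
qed

lemma reducible_lift: "reducible_L_lift M L C \<Gamma> lift_connection"
proof -
  have par: "parallel_1form M lift_connection L" "parallel_1form M lift_connection \<Gamma>"
    by (simp_all add: parallel_1form_def lift_connection VF_L VF_\<Gamma> lift_L lift_\<Gamma>)
  \<comment> \<open>With \<open>K = v\<close> the inverse on the vertical bundle is the identity, so
    the formula becomes \<open>I - 2v\<close>, which is \<open>\<Gamma>\<close>.\<close>
  have ind: "induced_connection M L C lift_connection \<Gamma>"
    unfolding induced_connection_def
  proof (intro exI[of _ v] conjI ballI allI)
    fix z w assume z: "z \<in> points M"
    have V: "v z w \<in> vertical_space L z"
      unfolding vertical_space_def range_L[OF z] by (simp add: L_v[OF z])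
    have "inj_on (v z) (vertical_space L z)"
      using regular_lift z by (simp add: regular_1form_def bij_betw_def)
    from inv_into_f_f[OF this V] have "inv_into (vertical_space L z) (v z) (v z w) = v z w"
      by (simp add: v_v[OF z])
    then show "\<Gamma> z w = w - 2 *\<^sub>R inv_into (vertical_space L z) (v z) (v z w)"
      by (simp add: v_def)
  qed (rule regular_lift)
  have "L_normal M L C lift_connection"
    by (simp add: L_normal_def L_almost_tangent_def linear_connection_lift par lift_connection
        VF_L VF_C lift_C app1_compose)
  moreover have "L_regular M L C lift_connection"
    using regular_lift by (auto simp: L_regular_def L_almost_tangent_def linear_connection_lift par)
  ultimately show ?thesis
    by (simp add: reducible_L_lift_def L_lift_def L_reducible_def ind par)
qed

lemma torsion_lift:
  assumes X: "X \<in> VF" and Y: "Y \<in> VF"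
  shows "torsion M lift_connection (app1 M L X) Y = app2 M B X Y"
  using lift_torsion[OF X Y] by (simp add: torsion_def fun_eq_iff lift_connection X Y VF_L)

section \<open>Uniqueness: the four components of the connection\<close>

lemma lift_unique:
  assumes D: "linear_connection M D" and DL: "parallel_1form M D L" and D\<Gamma>: "parallel_1form M D \<Gamma>"
    and T: "\<And>X Y. X \<in> VF \<Longrightarrow> Y \<in> VF \<Longrightarrow> torsion M D (app1 M L X) Y = app2 M B X Y"
  shows "D = lift_connection"
proof -
  have ext: "D \<in> VF \<rightarrow>\<^sub>E VF \<rightarrow>\<^sub>E VF"
    and add_left: "\<And>X X' Y p. X \<in> VF \<Longrightarrow> X' \<in> VF \<Longrightarrow> Y \<in> VF \<Longrightarrow> D (\<lambda>p. X p + X' p) Y p = D X Y p + D X' Y p"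
    and add_right: "\<And>X Y Y' p. X \<in> VF \<Longrightarrow> Y \<in> VF \<Longrightarrow> Y' \<in> VF \<Longrightarrow> D X (\<lambda>p. Y p + Y' p) p = D X Y p + D X Y' p"
    using D by (simp_all add: linear_connection_def)
  have VF_D: "D X Y \<in> VF" if "X \<in> VF" "Y \<in> VF" for X Y using ext that by (auto simp: PiE_iff)
  have D_L: "D X (app1 M L Y) = app1 M L (D X Y)" and D_\<Gamma>: "D X (app1 M \<Gamma> Y) = app1 M \<Gamma> (D X Y)"
    if "X \<in> VF" "Y \<in> VF" for X Y
    using DL D\<Gamma> that by (auto simp: parallel_1form_def)
  \<comment> \<open>Parallelism passes from \<open>\<Gamma>\<close> to \<open>h\<close> through
    \<open>\<Gamma> + I = 2h\<close>.\<close>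
  have D_h: "D X (app1 M h Y) p = h p (D X Y p)" if X: "X \<in> VF" and Y: "Y \<in> VF" and p: "p \<in> points M" for X Y p
  proof -
    have "D X (app1 M h Y) p + D X (app1 M h Y) p = D X (app1 M \<Gamma> Y) p + D X Y p"
      unfolding add_right[OF X VF_\<Gamma>[OF Y] Y, symmetric] add_right[OF X VF_h[OF Y] VF_h[OF Y], symmetric]
      by (simp add: app1_\<Gamma>[OF Y])
    also have "\<dots> = h p (D X Y p) + h p (D X Y p)"
      using p by (simp add: D_\<Gamma> X Y app1_point \<Gamma>_eq)
    finally show ?thesis by (simp flip: scaleR_2)
  qed
  have D_v: "D X (app1 M v Y) p = v p (D X Y p)" if X: "X \<in> VF" and Y: "Y \<in> VF" and p: "p \<in> points M" for X Y p
    using add_right[OF X VF_h[OF Y] VF_v[OF Y], of p]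
    by (simp add: app1_h_v_sum[OF Y] D_h[OF X Y p] h_eq[OF p])
  have D_Lp: "D X (app1 M L Y) p = L p (D X Y p)" if "X \<in> VF" "Y \<in> VF" "p \<in> points M" for X Y p
    using that by (simp add: D_L app1_point)
  \<comment> \<open>The torsion condition is evaluated at \<open>RX\<close>, which \<open>L\<close>
    turns into \<open>vX\<close>.\<close>
  have tor: "D (app1 M v X) (app1 M h Y) p - D (app1 M h Y) (app1 M v X) p
      - lie_bracket M (app1 M v X) (app1 M h Y) p = B p (app1 M R X p) (Y p)"
    if X: "X \<in> VF" and Y: "Y \<in> VF" and p: "p \<in> points M" for X Y p
    using fun_cong[OF T[OF VF_R[OF X] VF_h[OF Y]], of p] p
    by (simp add: torsion_def app1_compose app2_def B_simps Y)
  \<comment> \<open>The derivative of \<open>hY\<close> is horizontal and that of \<open>vX\<close>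
    vertical, so applying \<open>h\<close> or \<open>v\<close> to \<open>tor\<close> isolates one of
    them each time.\<close>
  have vh: "D (app1 M v X) (app1 M h Y) p = h p (lie_bracket M (app1 M v X) (app1 M h Y) p)"
    and hv: "D (app1 M h Y) (app1 M v X) p = v p (lie_bracket M (app1 M h Y) (app1 M v X) p) - B p (app1 M R X p) (Y p)"
    if X: "X \<in> VF" and Y: "Y \<in> VF" and p: "p \<in> points M" for X Y p
  proof -
    have a: "h p (D (app1 M v X) (app1 M h Y) p) = D (app1 M v X) (app1 M h Y) p"
        "v p (D (app1 M v X) (app1 M h Y) p) = 0"
        "h p (D (app1 M h Y) (app1 M v X) p) = 0"
        "v p (D (app1 M h Y) (app1 M v X) p) = D (app1 M h Y) (app1 M v X) p"
      using X Y p by (simp_all add: D_h D_v VF_h VF_v point_simps)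
    show "D (app1 M v X) (app1 M h Y) p = h p (lie_bracket M (app1 M v X) (app1 M h Y) p)"
      using arg_cong[OF tor[OF that], of "h p"] a p by (simp add: point_simps B_simps)
    show "D (app1 M h Y) (app1 M v X) p = v p (lie_bracket M (app1 M h Y) (app1 M v X) p) - B p (app1 M R X p) (Y p)"
      using arg_cong[OF tor[OF that], of "v p"] a p lie_bracket_skew[of "app1 M v X" "app1 M h Y" p]
      by (simp add: point_simps B_simps algebra_simps)
  qed
  \<comment> \<open>\<open>vY\<close> is \<open>L(RY)\<close> with \<open>RY\<close> horizontal, so
    the parallel form \<open>L\<close> carries \<open>vh\<close> for \<open>RY\<close> over to
    \<open>vY\<close>.\<close>
  have vv: "D (app1 M v X) (app1 M v Y) p = L p (lie_bracket M (app1 M v X) (app1 M R Y) p)"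
    if X: "X \<in> VF" and Y: "Y \<in> VF" and p: "p \<in> points M" for X Y p
    using D_Lp[OF VF_v[OF X] VF_R[OF Y] p] vh[OF X VF_R[OF Y] p] p
    by (simp add: app1_compose point_simps)
  \<comment> \<open>A horizontal vector is determined by its image under \<open>L\<close>; here that
    image is the derivative of \<open>LY\<close> along \<open>hX\<close>, known from
    \<open>hv\<close>.\<close>
  have hh: "D (app1 M h X) (app1 M h Y) p = R p (lie_bracket M (app1 M h X) (app1 M L Y) p - B p (Y p) (X p))"
    if X: "X \<in> VF" and Y: "Y \<in> VF" and p: "p \<in> points M" for X Y p
  proof (rule R_eqI[OF p, symmetric])
    show "v p (D (app1 M h X) (app1 M h Y) p) = 0"
      using X Y p by (simp add: D_h VF_h point_simps)
    show "L p (D (app1 M h X) (app1 M h Y) p) = v p (lie_bracket M (app1 M h X) (app1 M L Y) p - B p (Y p) (X p))"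
      using D_Lp[OF VF_h[OF X] VF_h[OF Y] p] hv[OF VF_L[OF Y] X p] p Y
      by (simp add: app1_compose point_simps B_simps)
  qed
  have eq: "D X Y = lift X Y" if X: "X \<in> VF" and Y: "Y \<in> VF" for X Y
  proof
    fix p
    show "D X Y p = lift X Y p"
    proof (cases "p \<in> points M")
      case p: True
      have "D X Y p = D (\<lambda>p. app1 M h X p + app1 M v X p) (\<lambda>p. app1 M h Y p + app1 M v Y p) p"
        by (simp add: app1_h_v_sum X Y)
      also have "\<dots> = D (app1 M h X) (app1 M h Y) p + D (app1 M h X) (app1 M v Y) p
          + (D (app1 M v X) (app1 M h Y) p + D (app1 M v X) (app1 M v Y) p)"
        by (simp add: add_left add_right VF_intros X Y)
      also have "\<dots> = lift X Y p"
        using p by (simp add: hh hv vh vv X Y lift_point)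
      finally show ?thesis .
    qed (use X Y in \<open>simp add: lift_outside vector_fields_outside[OF VF_D]\<close>)
  qed
  \<comment> \<open>Extensionality is needed in each argument, since a connection is
    \<open>undefined\<close> off the vector fields.\<close>
  show ?thesis
  proof (rule PiE_ext[OF ext])
    show "lift_connection \<in> VF \<rightarrow>\<^sub>E VF \<rightarrow>\<^sub>E VF"
      using linear_connection_lift by (simp add: linear_connection_def)
    show "D X = lift_connection X" if X: "X \<in> VF" for X
    proof (rule PiE_ext)
      show "D X \<in> VF \<rightarrow>\<^sub>E VF" using ext X by (rule PiE_mem)
      show "lift_connection X \<in> VF \<rightarrow>\<^sub>E VF"
        using linear_connection_lift X by (auto simp: linear_connection_def intro: PiE_mem)
    qed (simp add: lift_connection eq X)
  qed
qed

end

theorem theorem3p4: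
  fixes M :: "('a, 'e::euclidean_space) manifold" and n :: nat
    and L \<Gamma> :: "('a, 'e) form1" and B :: "('a, 'e) form2" and C :: "'a \<Rightarrow> 'e"
  assumes "smooth_manifold M" and "DIM('e) = 2 * n"
    and "vertical_endomorphism M n L"
    and "canonical_field M L C"
    and "L_connection M L \<Gamma>"
    and "vector_2form M B" and "semibasic2 M L B"
    and "\<forall>X\<in>vector_fields M. \<forall>p\<in>points M.
           app1 M (potential M L C B) X p + fn_bracket01 M C (horizontal_projector \<Gamma>) X p = 0"
  shows "\<exists>!D. reducible_L_lift M L C \<Gamma> D \<and>
           (\<forall>X\<in>vector_fields M. \<forall>Y\<in>vector_fields M.
              torsion M D (app1 M L X) Y = app2 M B X Y)"
proof -
  interpret semibasic_torsion_mfd M n L \<Gamma> C B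
    using assms by unfold_locales auto
  show ?thesis
  proof (rule ex1I[of _ lift_connection])
    fix D
    assume D: "reducible_L_lift M L C \<Gamma> D \<and>
       (\<forall>X\<in>vector_fields M. \<forall>Y\<in>vector_fields M. torsion M D (app1 M L X) Y = app2 M B X Y)"
    show "D = lift_connection"
      by (rule lift_unique) (use D in \<open>auto simp: reducible_L_lift_def L_reducible_def L_lift_def
          L_normal_def L_almost_tangent_def\<close>)
  qed (simp add: reducible_lift torsion_lift)
qed

end
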